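(* Let $G$ be an Abelian topological group. Then every tame minimal $G$-system $(X,G)$ is uniquely ergodic, i.e., it has exactly one $G$-invariant Borel probability measure.
   Context: $(X,G)$ is a compact Hausdorff space with a continuous $G$-action; minimal means every orbit is dense. For $s\in G$, $f\in C(X)$, $sf$ denotes $x\mapsto f(sx)$. $(X,G)$ is tame if no $f\in C(X)$ has an infinite $\ell_1$-isomorphism set, i.e., there is no infinite $I\subseteq G$ such that $\{sf\}_{s\in I}$ is equivalent to the standard basis of $\ell_1^I$. *)

theory Defs
  imports "HOL-Analysis.Analysis" "HOL-Probability.Probability"
begin

definition dyn_system :: "('g::topological_group_add \<Rightarrow> 'x::t2_space \<Rightarrow> 'x) \<Rightarrow> bool" where
  "dyn_system act \<longleftrightarrow>
     compact (UNIV :: 'x set) \<and>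
     (\<forall>x. act 0 x = x) \<and>
     (\<forall>g h x. act (g + h) x = act g (act h x)) \<and>
     continuous_on UNIV (\<lambda>(g, x). act g x)"

definition minimal_system :: "('g \<Rightarrow> 'x::topological_space \<Rightarrow> 'x) \<Rightarrow> bool" where
  "minimal_system act \<longleftrightarrow> (\<forall>x. closure (range (\<lambda>g. act g x)) = UNIV)"

definition sup_norm :: "('x \<Rightarrow> real) \<Rightarrow> real" where
  "sup_norm f = Sup (range (\<lambda>x. \<bar>f x\<bar>))"

text \<open>I is an l1-isomorphism set for f: the family (s f)_{s in I}, where
(s f)(x) = f(s x), is equivalent to the standard basis of l1(I).\<close>
definition l1_isomorphism_set :: "('g \<Rightarrow> 'x \<Rightarrow> 'x) \<Rightarrow> ('x \<Rightarrow> real) \<Rightarrow> 'g set \<Rightarrow> bool" where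
  "l1_isomorphism_set act f I \<longleftrightarrow>
     (\<exists>A B. 0 < A \<and> 0 < B \<and>
        (\<forall>F c. finite F \<longrightarrow> F \<subseteq> I \<longrightarrow>
           A * (\<Sum>s\<in>F. \<bar>c s\<bar>) \<le> sup_norm (\<lambda>x. \<Sum>s\<in>F. c s * f (act s x)) \<and>
           sup_norm (\<lambda>x. \<Sum>s\<in>F. c s * f (act s x)) \<le> B * (\<Sum>s\<in>F. \<bar>c s\<bar>)))"

definition tame_system :: "('g \<Rightarrow> 'x::topological_space \<Rightarrow> 'x) \<Rightarrow> bool" where
  "tame_system act \<longleftrightarrow>
     \<not> (\<exists>f I. continuous_on UNIV f \<and> infinite I \<and> l1_isomorphism_set act f I)"

text \<open>Probability measures on X: (regular, i.e. Radon) Borel probability measures,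
the standard meaning of M(X) in topological dynamics (dual of C(X) via Riesz).\<close>
definition radon_prob :: "'x::topological_space measure \<Rightarrow> bool" where
  "radon_prob M \<longleftrightarrow> sets M = sets borel \<and> prob_space M \<and>
     (\<forall>A\<in>sets borel. measure M A = (SUP K\<in>{K. compact K \<and> K \<subseteq> A}. measure M K))"

definition invariant_measure :: "('g \<Rightarrow> 'x::topological_space \<Rightarrow> 'x) \<Rightarrow> 'x measure \<Rightarrow> bool" where
  "invariant_measure act M \<longleftrightarrow>
     (\<forall>g. \<forall>A\<in>sets borel. emeasure M (act g -` A) = emeasure M A)"

definition uniquely_ergodic :: "('g \<Rightarrow> 'x::topological_space \<Rightarrow> 'x) \<Rightarrow> bool" where
  "uniquely_ergodic act \<longleftrightarrow> (\<exists>!M. radon_prob M \<and> invariant_measure act M)"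

end

theory Submission
  imports Defs
begin

text \<open>
  It suffices to find, for every continuous \<open>f\<close> and every \<open>\<epsilon> > 0\<close>, a finite average of translates of
  \<open>f\<close> with oscillation at most \<open>\<epsilon>\<close>: then any two invariant measures agree on \<open>f\<close>. An invariant
  Radon measure exists because a limit of almost invariant averages along an orbit is an invariant
  finitely additive probability on all subsets, whose restriction to compact sets is a content.

  If small oscillation fails for \<open>f\<close>, a limit along an ultrafilter yields an invariant finitely
  additive law of pairs \<open>(t, h)\<close> for which the mean of \<open>f (t x)\<close> is smaller than that of
  \<open>f ((t + h) x)\<close>, hence levels \<open>a < b\<close> such that the probabilities of \<open>f (t x) < a\<close> and
  \<open>f ((t + h) x) > b\<close> have sum greater than 1. Tameness forces the translates of these events to be
  totally bounded in measure, since a separated sequence of translates would contain an infinite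
  independence set. Therefore \<open>x\<close> returns to each of its neighbourhoods at times \<open>r + h\<close> that almost
  preserve the events, and such returns double the number of patterns realised over the times
  \<open>t\<close> chosen so far. This again builds an infinite independence set, contradicting tameness.
\<close>

section \<open>Ultrafilters\<close>

definition ultrafilter :: "'i filter \<Rightarrow> bool" where
  "ultrafilter U \<longleftrightarrow> U \<noteq> bot \<and> (\<forall>P. eventually P U \<or> eventually (\<lambda>i. \<not> P i) U)"

lemma ultrafilterD: "ultrafilter U \<Longrightarrow> \<not> eventually P U \<Longrightarrow> eventually (\<lambda>i. \<not> P i) U"
  by (auto simp: ultrafilter_def)

lemma ultrafilter_not_bot: "ultrafilter U \<Longrightarrow> U \<noteq> bot"
  by (simp add: ultrafilter_def)

text \<open>Zorn's lemma for reverse inclusion of proper filters. The infimum of a chain stays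
  proper because whatever holds eventually along it already does so along one member. A minimal
  proper filter decides every \<open>P\<close>: if the negation is not eventual, the meet with
  \<open>P\<close> is proper and therefore equal to the filter.\<close>

lemma ultrafilter_refines:
  assumes "F \<noteq> (bot :: 'i filter)"
  obtains U where "U \<le> F" "ultrafilter U"
proof -
  define A where "A = {G. G \<le> F \<and> G \<noteq> bot}"
  have "\<exists>M\<in>A. \<forall>G\<in>A. M \<ge> G \<longrightarrow> G = M"
  proof (rule predicate_Zorn)
    show "partial_order_on A (relation_of (\<lambda>M G. M \<ge> G) A)"
      by (auto simp: partial_order_on_def preorder_on_def refl_on_def trans_def antisym_def relation_of_def)
    fix C assume "C \<in> Chains (relation_of (\<lambda>M G. M \<ge> G) A)"
    then have C: "C \<subseteq> A" "\<And>G H. G \<in> C \<Longrightarrow> H \<in> C \<Longrightarrow> G \<le> H \<or> H \<le> G"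
      by (auto simp: Chains_def relation_of_def)
    show "\<exists>u\<in>A. \<forall>a\<in>C. a \<ge> u"
    proof (cases "C = {}")
      case True
      then show ?thesis using assms by (auto simp: A_def)
    next
      case False
      have "eventually P (Inf C) \<longleftrightarrow> (\<exists>b\<in>C. eventually P b)" for P
        using False C(2) by (intro eventually_Inf_base) (metis inf.absorb1 inf.absorb2 order_refl)+
      then have "Inf C \<noteq> bot"
        using C(1) by (auto simp: A_def trivial_limit_def)
      moreover have "Inf C \<le> F"
        using False C(1) by (auto simp: A_def intro: Inf_lower2)
      ultimately show ?thesis by (auto simp: A_def intro!: bexI[of _ "Inf C"] Inf_lower)
    qed
  qed
  then obtain M where M: "M \<le> F" "M \<noteq> bot" "\<And>G. G \<le> M \<Longrightarrow> G \<noteq> bot \<Longrightarrow> G = M"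
    unfolding A_def by (auto dest: order_trans)
  have "eventually P M" if "\<not> eventually (\<lambda>i. \<not> P i) M" for P
  proof -
    have "inf M (principal {i. P i}) \<noteq> bot"
      using that by (simp add: trivial_limit_def eventually_inf_principal)
    then have "inf M (principal {i. P i}) = M" by (intro M(3)) auto
    then have "M \<le> principal {i. P i}" by (metis inf.cobounded2)
    then show ?thesis by (simp add: le_principal)
  qed
  then have "ultrafilter M" using M(2) by (auto simp: ultrafilter_def)
  with M(1) that show ?thesis by blast
qed

text \<open>The invariant laws below are limits along such an ultrafilter: any finitely many
  requirements are met by one index, so each requirement holds eventually.\<close>

lemma ultrafilter_finite_intersections:
  assumes "\<And>X. finite X \<Longrightarrow> X \<subseteq> \<S> \<Longrightarrow> \<Inter>X \<noteq> ({} :: 'i set)"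
  obtains U where "ultrafilter U" "\<And>S. S \<in> \<S> \<Longrightarrow> eventually (\<lambda>i. i \<in> S) U"
proof -
  have "(INF S\<in>\<S>. principal S) \<noteq> bot"
  proof
    assume "(INF S\<in>\<S>. principal S) = (bot :: 'i filter)"
    then have "eventually (\<lambda>_. False) (INF S\<in>\<S>. principal S)"
      by simp
    then obtain X where "X \<subseteq> \<S>" "finite X" "eventually (\<lambda>_. False) (INF S\<in>X. principal S)"
      using eventually_INF[of "\<lambda>_. False" principal \<S>] by auto
    then show False using assms[of X] by (simp add: INF_principal_finite eventually_principal) blast
  qed
  then obtain U where U: "U \<le> (INF S\<in>\<S>. principal S)" "ultrafilter U"
    by (rule ultrafilter_refines)
  have "eventually (\<lambda>i. i \<in> S) U" if "S \<in> \<S>" for S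
    using U(1) that by (metis INF_lower order_trans le_principal)
  with U(2) that show ?thesis by blast
qed

lemma ultrafilter_filtermap: "ultrafilter U \<Longrightarrow> ultrafilter (filtermap g U)"
  by (auto simp: ultrafilter_def eventually_filtermap filtermap_bot_iff)

lemma ultrafilter_eventually_bex:
  assumes "ultrafilter U" "finite K" "eventually (\<lambda>i. \<exists>k\<in>K. P k i) U"
  shows "\<exists>k\<in>K. eventually (P k) U"
proof (rule ccontr)
  assume "\<not> ?thesis"
  then have "\<forall>k\<in>K. eventually (\<lambda>i. \<not> P k i) U"
    using assms(1) ultrafilterD by blast
  then have "eventually (\<lambda>i. \<forall>k\<in>K. \<not> P k i) U"
    using assms(2) by (simp add: eventually_ball_finite)
  with assms(3) have "eventually (\<lambda>_. False) U"
    by eventually_elim blast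
  with assms(1) show False by (simp add: ultrafilter_def)
qed

text \<open>Compactness gives a cluster point, and an ultrafilter converges to each of its cluster
  points.\<close>

lemma ultrafilter_compact_limit:
  assumes U: "ultrafilter U" and K: "compact K" "eventually (\<lambda>i. \<phi> i \<in> K) U"
  obtains l where "l \<in> K" "(\<phi> \<longlongrightarrow> l) U"
proof -
  let ?F = "filtermap \<phi> U"
  have U': "ultrafilter ?F" using U by (rule ultrafilter_filtermap)
  have "eventually (\<lambda>x. x \<in> K) ?F" using K(2) by (simp add: eventually_filtermap)
  with K(1) U' obtain l where l: "l \<in> K" "inf (nhds l) ?F \<noteq> bot"
    unfolding compact_filter by (metis ultrafilter_not_bot)
  have "(\<phi> \<longlongrightarrow> l) U"
  proof (rule topological_tendstoI)
    fix S assume S: "open S" "l \<in> S"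
    show "eventually (\<lambda>i. \<phi> i \<in> S) U"
    proof (rule ccontr)
      assume "\<not> ?thesis"
      then have "eventually (\<lambda>x. x \<notin> S) ?F"
        using U by (auto simp: eventually_filtermap dest: ultrafilterD)
      moreover have "eventually (\<lambda>x. x \<in> S) (nhds l)"
        using S by (rule eventually_nhds_in_open)
      ultimately have "eventually (\<lambda>_. False) (inf (nhds l) ?F)"
        unfolding eventually_inf by blast
      with l(2) show False by simp
    qed
  qed
  with l(1) that show ?thesis by blast
qed

lemma ultrafilter_tendsto_Lim:
  fixes \<phi> :: "'i \<Rightarrow> real"
  assumes U: "ultrafilter U" and "eventually (\<lambda>i. \<bar>\<phi> i\<bar> \<le> B) U"
  shows "(\<phi> \<longlongrightarrow> Lim U \<phi>) U"
proof -
  have "eventually (\<lambda>i. \<phi> i \<in> {-B..B}) U"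
    using assms(2) by eventually_elim auto
  then obtain l where "(\<phi> \<longlongrightarrow> l) U"
    using ultrafilter_compact_limit[OF U, of "{-B..B}"] by auto
  then show ?thesis using tendsto_Lim[OF ultrafilter_not_bot[OF U]] by metis
qed

section \<open>Finitely additive probabilities\<close>

text \<open>The probability is defined on all subsets, so images and ultrafilter limits raise no
  question of measurability.\<close>

locale finadd =
  fixes m :: "'o set \<Rightarrow> real"
  assumes nonneg: "0 \<le> m A"
    and total: "m UNIV = 1"
    and additive: "A \<inter> B = {} \<Longrightarrow> m (A \<union> B) = m A + m B"
begin

lemma empty [simp]: "m {} = 0"
  using additive[of "{}" "{}"] by simp

lemma mono: "A \<subseteq> B \<Longrightarrow> m A \<le> m B"
  using additive[of A "B - A"] nonneg[of "B - A"] by (simp add: Un_absorb1)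

lemma split: "m A = m (A \<inter> B) + m (A - B)"
  using additive[of "A \<inter> B" "A - B"] by (simp add: Int_Diff_disjoint Int_Diff_Un)

lemma le_one: "m A \<le> 1"
  using mono[of A UNIV] total by simp

lemma compl: "m (- A) = 1 - m A"
  using split[of UNIV A] total by (simp add: Compl_eq_Diff_UNIV)

lemma subadditive: "m (A \<union> B) \<le> m A + m B"
  using additive[of A "B - A"] mono[of "B - A" B] by auto

lemma subadditive_UN: "finite I \<Longrightarrow> m (\<Union>i\<in>I. A i) \<le> (\<Sum>i\<in>I. m (A i))"
proof (induction I rule: finite_induct)
  case (insert i I)
  then show ?case using subadditive[of "A i" "\<Union>i\<in>I. A i"] by simp
qed simp

lemma le_Un: "A \<subseteq> B \<union> C \<Longrightarrow> m A \<le> m B + m C"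
  using mono[of A "B \<union> C"] subadditive[of B C] by linarith

lemma Int_ge: "m (A \<inter> B) \<ge> m A + m B - 1"
  using split[of A B] mono[of "A - B" "- B"] compl[of B] by (simp add: Diff_eq)

lemma vimage: "finadd (\<lambda>Y. m (g -` Y))"
  by unfold_locales (auto simp: nonneg total vimage_Un intro!: additive)

end

text \<open>Only finite additivity is asked for because it passes to limits along an ultrafilter,
  whereas countable additivity can be lost.\<close>

lemma finadd_Lim:
  assumes U: "ultrafilter U" and \<nu>: "eventually (\<lambda>i. finadd (\<nu> i)) U"
  shows "finadd (\<lambda>P. Lim U (\<lambda>i. \<nu> i P))"
    and "((\<lambda>i. \<nu> i P) \<longlongrightarrow> Lim U (\<lambda>i. \<nu> i P)) U"
proof -
  have lim: "((\<lambda>i. \<nu> i P) \<longlongrightarrow> Lim U (\<lambda>i. \<nu> i P)) U" for P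
    using \<nu> by (intro ultrafilter_tendsto_Lim[OF U, where B = 1])
      (auto elim!: eventually_mono simp: finadd.nonneg finadd.le_one)
  then show "((\<lambda>i. \<nu> i P) \<longlongrightarrow> Lim U (\<lambda>i. \<nu> i P)) U" .
  note [simp] = ultrafilter_not_bot[OF U]
  show "finadd (\<lambda>P. Lim U (\<lambda>i. \<nu> i P))"
  proof
    show "0 \<le> Lim U (\<lambda>i. \<nu> i A)" for A
      by (rule tendsto_lowerbound[OF lim]) (use \<nu> in \<open>auto elim!: eventually_mono simp: finadd.nonneg\<close>)
    have "eventually (\<lambda>i. \<nu> i UNIV = 1) U"
      using \<nu> by (auto elim!: eventually_mono simp: finadd.total)
    then show "Lim U (\<lambda>i. \<nu> i UNIV) = 1"
      by (intro tendsto_Lim tendsto_eventually) auto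
    fix A B :: "'b set" assume AB: "A \<inter> B = {}"
    have "eventually (\<lambda>i. \<nu> i A + \<nu> i B = \<nu> i (A \<union> B)) U"
      using \<nu> by (auto elim!: eventually_mono simp: finadd.additive[OF _ AB])
    then show "Lim U (\<lambda>i. \<nu> i (A \<union> B)) = Lim U (\<lambda>i. \<nu> i A) + Lim U (\<lambda>i. \<nu> i B)"
      by (intro tendsto_Lim Lim_transform_eventually[OF tendsto_add[OF lim lim]]) auto
  qed
qed

text \<open>\<open>J\<close> is the union of a growing chain of sets with \<open>P\<close>. Since
  \<open>P\<close> is not assumed to pass to subsets, a finite part of \<open>J\<close> is only
  placed inside some \<open>T\<close> with \<open>P T\<close>.\<close>

lemma infinite_set_by_extension:
  assumes "P {}" and step: "\<And>T. finite T \<Longrightarrow> P T \<Longrightarrow> \<exists>t. t \<notin> T \<and> P (insert t T)"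
  obtains J where "infinite J" "\<And>F. finite F \<Longrightarrow> F \<subseteq> J \<Longrightarrow> \<exists>T. F \<subseteq> T \<and> P T"
proof -
  have "\<exists>T. \<forall>n :: nat. (finite (T n) \<and> P (T n)) \<and> (\<exists>t. t \<notin> T n \<and> T (Suc n) = insert t (T n))"
  proof (rule dependent_nat_choice[where P = "\<lambda>_ T. finite T \<and> P T"
        and Q = "\<lambda>_ T T'. \<exists>t. t \<notin> T \<and> T' = insert t T"])
    show "\<exists>x. finite x \<and> P x" using assms(1) by blast
    show "\<exists>y. (finite y \<and> P y) \<and> (\<exists>t. t \<notin> x \<and> y = insert t x)" if "finite x \<and> P x" for x and n :: nat
      using step[of x] that by blast
  qed
  then obtain T where T: "\<And>n :: nat. finite (T n) \<and> P (T n)" "\<And>n. \<exists>t. t \<notin> T n \<and> T (Suc n) = insert t (T n)"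
    by metis
  have "incseq T" using T(2) by (intro incseq_SucI) (metis subset_insertI)
  have card: "card (T n) \<ge> n" for n
  proof (induction n)
    case (Suc n)
    then show ?case using T(1)[of n] T(2)[of n] by (auto simp: card_insert_if)
  qed simp
  have "infinite (\<Union>n. T n)"
  proof
    assume fin: "finite (\<Union>n. T n)"
    let ?n = "Suc (card (\<Union>n. T n))"
    have "card (T ?n) \<le> card (\<Union>n. T n)" by (rule card_mono[OF fin]) blast
    with card[of ?n] show False by simp
  qed
  moreover have "\<exists>n. F \<subseteq> T n" if "finite F" "F \<subseteq> (\<Union>n. T n)" for F
    using that
  proof (induction F rule: finite_induct)
    case (insert x F)
    then obtain n k where "F \<subseteq> T n" "x \<in> T k" by auto
    then have "insert x F \<subseteq> T (max n k)"
      using incseqD[OF \<open>incseq T\<close>, of n "max n k"] incseqD[OF \<open>incseq T\<close>, of k "max n k"] by auto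
    then show ?case ..
  qed simp
  ultimately show ?thesis using that T(1) by metis
qed

text \<open>Let \<open>\<theta>\<close> be the meet of the limit measures \<open>\<alpha>\<close> and \<open>\<beta>\<close>. If \<open>\<theta> C > 0\<close>, then \<open>\<theta> (C \<inter> A s) > 0\<close> for
  almost all \<open>s\<close>: removing from \<open>C\<close> sets \<open>A s\<close> with \<open>\<theta> (C \<inter> A s) = 0\<close> does not change \<open>\<theta> \<le> \<alpha>\<close>, so
  each of infinitely many removals would cost at least \<open>\<theta> C / 2\<close> of the measure \<open>m\<close>. The same
  holds for \<open>B\<close>.\<close>

lemma (in finadd) independent_subset:
  fixes A B :: "'s \<Rightarrow> 'o set"
  assumes S: "infinite S" and \<epsilon>: "\<epsilon> > 0"
    and sep: "\<And>s s'. s \<in> S \<Longrightarrow> s' \<in> S \<Longrightarrow> s \<noteq> s' \<Longrightarrow> m (A s \<inter> B s') + m (A s' \<inter> B s) \<ge> \<epsilon>"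
  obtains J where "infinite J"
    "\<And>F Q. finite F \<Longrightarrow> F \<subseteq> J \<Longrightarrow> Q \<subseteq> F \<Longrightarrow> (\<Inter>s\<in>Q. B s) \<inter> (\<Inter>s\<in>F - Q. A s) \<noteq> {}"
proof -
  \<comment> \<open>An ultrafilter \<open>V\<close> finer than this filter lives on \<open>S\<close>
    and avoids every finite set, so indices chosen along it can always be new.\<close>
  have "inf (principal S) cofinite \<noteq> bot"
  proof
    assume "inf (principal S) cofinite = bot"
    then have "eventually (\<lambda>_. False) (inf cofinite (principal S))"
      by (simp add: inf_commute)
    then have "eventually (\<lambda>s. s \<notin> S) cofinite"
      by (simp add: eventually_inf_principal)
    with S show False by (simp add: eventually_cofinite)
  qed
  then obtain V where V: "V \<le> inf (principal S) cofinite" "ultrafilter V"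
    by (rule ultrafilter_refines)
  note [simp] = ultrafilter_not_bot[OF V(2)] tendsto_Lim[OF ultrafilter_not_bot[OF V(2)] tendsto_const]
  have inS: "eventually (\<lambda>s. s \<in> S) V"
    using V(1) by (simp add: le_principal)
  have new: "eventually (\<lambda>s. s \<notin> T) V" if "finite T" for T
    using that V(1) by (intro filter_leD[where F = V and F' = cofinite]) (auto simp: eventually_cofinite)
  define \<alpha> \<beta> where "\<alpha> = (\<lambda>C. Lim V (\<lambda>s. m (C \<inter> A s)))" and "\<beta> = (\<lambda>C. Lim V (\<lambda>s. m (C \<inter> B s)))"
  have lim: "((\<lambda>s. m (C \<inter> Z s)) \<longlongrightarrow> Lim V (\<lambda>s. m (C \<inter> Z s))) V" for C and Z :: "'s \<Rightarrow> 'o set"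
    by (rule ultrafilter_tendsto_Lim[OF V(2), where B = 1]) (auto simp: nonneg le_one)
  have Lim_nonneg: "0 \<le> Lim V (\<lambda>s. m (C \<inter> Z s))" for C Z
    by (rule tendsto_lowerbound[OF lim]) (auto simp: nonneg)
  have Lim_le_Un: "Lim V (\<lambda>s. m (E \<inter> Z s)) \<le> Lim V (\<lambda>s. m (C \<inter> Z s)) + Lim V (\<lambda>s. m (D \<inter> Z s))"
    if "E \<subseteq> C \<union> D" for E C D Z
    by (rule tendsto_le[OF _ tendsto_add[OF lim lim] lim]) (use that in \<open>auto intro!: always_eventually le_Un\<close>)
  \<comment> \<open>The infimum over all cuts of \<open>C\<close> into two pieces is the lattice
    formula for the meet of two measures.\<close>
  define \<theta> where "\<theta> C = (INF D. \<alpha> (C \<inter> D) + \<beta> (C - D))" for C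
  have bdd: "bdd_below (range (\<lambda>D. \<alpha> (C \<inter> D) + \<beta> (C - D)))" for C
    by (rule bdd_belowI[of _ 0]) (auto simp: \<alpha>_def \<beta>_def Lim_nonneg)
  have \<theta>_nonneg: "\<theta> C \<ge> 0" for C
    unfolding \<theta>_def by (rule cINF_greatest) (auto simp: \<alpha>_def \<beta>_def Lim_nonneg)
  have \<theta>_Un: "\<theta> E \<le> \<theta> C + \<theta> D" if "E = C \<union> D" for C D E
  proof -
    have "\<theta> E - (\<alpha> (D \<inter> Y) + \<beta> (D - Y)) \<le> \<alpha> (C \<inter> X) + \<beta> (C - X)" for X Y
    proof -
      let ?W = "C \<inter> X \<union> D \<inter> Y"
      have "\<theta> E \<le> \<alpha> (E \<inter> ?W) + \<beta> (E - ?W)"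
        unfolding \<theta>_def by (rule cINF_lower[OF bdd]) simp
      moreover have "\<alpha> (E \<inter> ?W) \<le> \<alpha> (C \<inter> X) + \<alpha> (D \<inter> Y)"
        unfolding \<alpha>_def by (rule Lim_le_Un) auto
      moreover have "\<beta> (E - ?W) \<le> \<beta> (C - X) + \<beta> (D - Y)"
        unfolding \<beta>_def using that by (intro Lim_le_Un) auto
      ultimately show ?thesis by linarith
    qed
    then have "\<theta> E - (\<alpha> (D \<inter> Y) + \<beta> (D - Y)) \<le> \<theta> C" for Y
      unfolding \<theta>_def[of C] by (intro cINF_greatest) auto
    then have "\<theta> E - \<theta> C \<le> \<theta> D"
      unfolding \<theta>_def[of D] by (intro cINF_greatest) (auto simp: algebra_simps)
    then show ?thesis by linarith
  qed
  have \<theta>_le: "\<theta> C \<le> \<alpha> C" "\<theta> C \<le> \<beta> C" for C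
    using cINF_lower[OF bdd[of C], of C] cINF_lower[OF bdd[of C], of "{}"]
    by (simp_all add: \<theta>_def \<alpha>_def \<beta>_def)
  have greedy: "eventually (\<lambda>s. \<theta> (C \<inter> Z s) > 0) V"
    if "\<theta> C > 0" and le: "\<And>C. \<theta> C \<le> Lim V (\<lambda>s. m (C \<inter> Z s))" for C Z
  proof (rule ccontr)
    assume "\<not> ?thesis"
    then have null: "eventually (\<lambda>s. \<not> \<theta> (C \<inter> Z s) > 0) V"
      by (rule ultrafilterD[OF V(2)])
    have "\<exists>E. \<theta> (C \<inter> E) \<le> 0 \<and> m (C \<inter> E) \<ge> real n * (\<theta> C / 2)" for n
    proof (induction n)
      case 0
      have "\<theta> {} \<le> 0" using \<theta>_le(1)[of "{}"] by (simp add: \<alpha>_def)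
      then show ?case by (intro exI[of _ "{}"]) simp
    next
      case (Suc n)
      then obtain E where E: "\<theta> (C \<inter> E) \<le> 0" "m (C \<inter> E) \<ge> real n * (\<theta> C / 2)" by blast
      have "\<theta> C \<le> \<theta> (C - E)" using \<theta>_Un[OF Int_Diff_Un[symmetric], of C E] E(1) by linarith
      also have "\<dots> \<le> Lim V (\<lambda>s. m ((C - E) \<inter> Z s))" by (rule le)
      finally have "eventually (\<lambda>s. m ((C - E) \<inter> Z s) > \<theta> C / 2) V"
        using \<open>\<theta> C > 0\<close> by (intro order_tendstoD(1)[OF lim]) auto
      then obtain s where s: "m ((C - E) \<inter> Z s) > \<theta> C / 2" "\<theta> (C \<inter> Z s) \<le> 0"
        using eventually_happens[OF eventually_conj[OF _ null]] by (auto simp: not_less)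
      have "\<theta> (C \<inter> (E \<union> Z s)) \<le> 0"
        using \<theta>_Un[OF Int_Un_distrib, of C E "Z s"] E(1) s(2) by linarith
      moreover have "m (C \<inter> (E \<union> Z s)) = m (C \<inter> E) + m ((C - E) \<inter> Z s)"
        by (subst split[of _ E]) (auto intro!: arg_cong2[where f = "(+)"] arg_cong[where f = m])
      ultimately show ?case
        using E(2) s(1) by (intro exI[of _ "E \<union> Z s"]) (auto simp: algebra_simps)
    qed
    moreover obtain n where "real n * (\<theta> C / 2) > 1"
      using reals_Archimedean3[of "\<theta> C / 2"] \<open>\<theta> C > 0\<close> by (metis half_gt_zero)
    ultimately show False using le_one by (meson not_le order_trans)
  qed
  \<comment> \<open>A cut \<open>D\<close> of smaller value would give two indices \<open>s\<close>,
    \<open>s'\<close> at which the pieces of \<open>A\<close> in \<open>D\<close> and of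
    \<open>B\<close> outside \<open>D\<close> together measure less than
    \<open>\<epsilon> / 2\<close>. These four pieces cover \<open>A s \<inter> B s'\<close> and
    \<open>A s' \<inter> B s\<close>, contrary to the separation by
    \<open>\<epsilon>\<close>.\<close>
  have "\<epsilon> / 2 \<le> \<theta> UNIV"
    unfolding \<theta>_def
  proof (rule cINF_greatest)
    fix D
    show "\<epsilon> / 2 \<le> \<alpha> (UNIV \<inter> D) + \<beta> (UNIV - D)"
    proof (rule ccontr)
      assume *: "\<not> ?thesis"
      have "((\<lambda>s. m (D \<inter> A s) + m ((UNIV - D) \<inter> B s)) \<longlongrightarrow> \<alpha> D + \<beta> (UNIV - D)) V"
        unfolding \<alpha>_def \<beta>_def by (intro tendsto_add lim)
      with * have "eventually (\<lambda>s. m (D \<inter> A s) + m ((UNIV - D) \<inter> B s) < \<epsilon> / 2) V"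
        by (intro order_tendstoD(2)) auto
      with inS have ev: "eventually (\<lambda>s. s \<in> S \<and> m (D \<inter> A s) + m ((UNIV - D) \<inter> B s) < \<epsilon> / 2) V"
        by eventually_elim simp
      then obtain s where s: "s \<in> S" "m (D \<inter> A s) + m ((UNIV - D) \<inter> B s) < \<epsilon> / 2"
        using eventually_happens[OF ev] by auto
      obtain s' where s': "s' \<noteq> s" "s' \<in> S" "m (D \<inter> A s') + m ((UNIV - D) \<inter> B s') < \<epsilon> / 2"
        using eventually_happens[OF eventually_conj[OF new[of "{s}"] ev]] by auto
      have "m (A s \<inter> B s') \<le> m (D \<inter> A s) + m ((UNIV - D) \<inter> B s')"
        "m (A s' \<inter> B s) \<le> m (D \<inter> A s') + m ((UNIV - D) \<inter> B s)"
        by (auto intro!: le_Un)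
      then show False using sep[of s s'] s s' by auto
    qed
  qed simp
  \<comment> \<open>Positive \<open>\<theta>\<close> is carried instead of mere nonemptiness: then
    \<open>greedy\<close> applies to each of the finitely many patterns on \<open>T\<close>, and one
    new \<open>s\<close> extends all of them in both ways.\<close>
  define P where "P T \<longleftrightarrow> (\<forall>Q\<subseteq>T. \<theta> ((\<Inter>s\<in>Q. B s) \<inter> (\<Inter>s\<in>T - Q. A s)) > 0)" for T
  obtain J where J: "infinite J" "\<And>F. finite F \<Longrightarrow> F \<subseteq> J \<Longrightarrow> \<exists>T. F \<subseteq> T \<and> P T"
  proof (rule infinite_set_by_extension[of P])
    show "P {}" using \<open>\<epsilon> / 2 \<le> \<theta> UNIV\<close> \<epsilon> by (simp add: P_def)
    fix T assume T: "finite T" "P T"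
    define C where "C Q = (\<Inter>s\<in>Q. B s) \<inter> (\<Inter>s\<in>T - Q. A s)" for Q
    have pos: "\<theta> (C Q) > 0" if "Q \<in> Pow T" for Q
      using T(2) that by (auto simp: P_def C_def)
    have "eventually (\<lambda>s. \<theta> (C Q \<inter> A s) > 0) V" "eventually (\<lambda>s. \<theta> (C Q \<inter> B s) > 0) V" if "Q \<in> Pow T" for Q
      using greedy[OF pos[OF that], of A] greedy[OF pos[OF that], of B] \<theta>_le by (auto simp: \<alpha>_def \<beta>_def)
    then have "eventually (\<lambda>s. s \<notin> T \<and> (\<forall>Q\<in>Pow T. \<theta> (C Q \<inter> A s) > 0) \<and> (\<forall>Q\<in>Pow T. \<theta> (C Q \<inter> B s) > 0)) V"
      using T(1) by (intro eventually_conj new eventually_ball_finite) auto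
    then obtain s where s: "s \<notin> T" "\<And>Q. Q \<subseteq> T \<Longrightarrow> \<theta> (C Q \<inter> A s) > 0" "\<And>Q. Q \<subseteq> T \<Longrightarrow> \<theta> (C Q \<inter> B s) > 0"
      by (auto dest!: eventually_happens)
    have "\<theta> ((\<Inter>s\<in>Q. B s) \<inter> (\<Inter>s\<in>insert s T - Q. A s)) > 0" if Q: "Q \<subseteq> insert s T" for Q
    proof (cases "s \<in> Q")
      case True
      then have "(\<Inter>s\<in>Q. B s) \<inter> (\<Inter>s\<in>insert s T - Q. A s) = C (Q - {s}) \<inter> B s"
        using s(1) by (auto simp: C_def)
      then show ?thesis using s(3)[of "Q - {s}"] Q by auto
    next
      case False
      then have "(\<Inter>s\<in>Q. B s) \<inter> (\<Inter>s\<in>insert s T - Q. A s) = C Q \<inter> A s"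
        using s(1) by (auto simp: C_def)
      then show ?thesis using s(2)[of Q] Q False by auto
    qed
    then show "\<exists>t. t \<notin> T \<and> P (insert t T)"
      using s(1) by (auto simp: P_def)
  qed blast
  show thesis
  proof (rule that[OF J(1)])
    fix F Q assume F: "finite F" "F \<subseteq> J" "Q \<subseteq> F"
    obtain T where T: "F \<subseteq> T" "P T" using J(2)[OF F(1,2)] by blast
    have "\<theta> {} \<le> 0" using \<theta>_le(1)[of "{}"] by (simp add: \<alpha>_def)
    then have "(\<Inter>s\<in>Q. B s) \<inter> (\<Inter>s\<in>T - Q. A s) \<noteq> {}"
      using T F(3) unfolding P_def by (metis less_le_not_le order_trans)
    then show "(\<Inter>s\<in>Q. B s) \<inter> (\<Inter>s\<in>F - Q. A s) \<noteq> {}"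
      using T(1) by blast
  qed
qed

text \<open>The distribution function of \<open>\<phi>\<close> is monotone, hence continuous at all
  but countably many levels. Continuity is needed because without countable additivity a null level
  set could still have windows of large mass around it.\<close>

lemma (in finadd) continuity_level:
  fixes \<phi> :: "'o \<Rightarrow> real"
  assumes "c < d"
  obtains a where "c < a" "a < d" "\<And>\<epsilon>. \<epsilon> > 0 \<Longrightarrow> \<exists>\<eta>>0. m {\<omega>. a - \<eta> \<le> \<phi> \<omega> \<and> \<phi> \<omega> \<le> a + \<eta>} < \<epsilon>"
proof -
  define g where "g v = m {\<omega>. \<phi> \<omega> \<le> v}" for v
  have "mono g" unfolding g_def by (intro monoI mono) auto
  then have "countable {v. \<not> isCont g v}" by (rule mono_ctble_discont)
  moreover have "uncountable {c<..<d}" using assms by (simp add: uncountable_open_interval)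
  ultimately obtain a where a: "c < a" "a < d" "isCont g a"
    by (metis (mono_tags, lifting) countable_subset greaterThanLessThan_iff mem_Collect_eq subsetI)
  have "\<exists>\<eta>>0. m {\<omega>. a - \<eta> \<le> \<phi> \<omega> \<and> \<phi> \<omega> \<le> a + \<eta>} < \<epsilon>" if "\<epsilon> > 0" for \<epsilon>
  proof -
    obtain \<delta> where \<delta>: "\<delta> > 0" "\<And>v. \<bar>v - a\<bar> < \<delta> \<Longrightarrow> \<bar>g v - g a\<bar> < \<epsilon> / 2"
      using a(3) \<open>\<epsilon> > 0\<close> unfolding continuous_at_eps_delta dist_real_def by (meson half_gt_zero)
    \<comment> \<open>The lower cut is at \<open>a - \<delta> / 2\<close>, not
      \<open>a - \<delta> / 3\<close>, so that the left end of the closed window is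
      included.\<close>
    have "m {\<omega>. \<phi> \<omega> \<le> a + \<delta> / 3} = m ({\<omega>. \<phi> \<omega> \<le> a + \<delta> / 3} \<inter> {\<omega>. \<phi> \<omega> \<le> a - \<delta> / 2})
        + m ({\<omega>. \<phi> \<omega> \<le> a + \<delta> / 3} - {\<omega>. \<phi> \<omega> \<le> a - \<delta> / 2})"
      by (rule split)
    moreover have "{\<omega>. \<phi> \<omega> \<le> a + \<delta> / 3} \<inter> {\<omega>. \<phi> \<omega> \<le> a - \<delta> / 2} = {\<omega>. \<phi> \<omega> \<le> a - \<delta> / 2}"
      using \<delta>(1) by auto
    moreover have "m {\<omega>. a - \<delta> / 3 \<le> \<phi> \<omega> \<and> \<phi> \<omega> \<le> a + \<delta> / 3}
        \<le> m ({\<omega>. \<phi> \<omega> \<le> a + \<delta> / 3} - {\<omega>. \<phi> \<omega> \<le> a - \<delta> / 2})"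
      using \<delta>(1) by (intro mono) auto
    moreover have "g (a + \<delta> / 3) - g (a - \<delta> / 2) < \<epsilon>"
    proof -
      have "\<bar>g (a + \<delta> / 3) - g a\<bar> < \<epsilon> / 2" "\<bar>g (a - \<delta> / 2) - g a\<bar> < \<epsilon> / 2"
        using \<delta>(1) by (intro \<delta>(2); simp)+
      then show ?thesis by linarith
    qed
    ultimately show ?thesis
      using \<delta>(1) unfolding g_def by (intro exI[of _ "\<delta> / 3"]) auto
  qed
  with a that show ?thesis by blast
qed

section \<open>Tame systems have no infinite independence sets\<close>

locale tame_dynamics =
  fixes act :: "'g::topological_ab_group_add \<Rightarrow> 'x::t2_space \<Rightarrow> 'x"
  assumes dyn: "dyn_system act" and tame: "tame_system act"
begin

lemma compact_UNIV: "compact (UNIV :: 'x set)"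
  and act_0 [simp]: "act 0 x = x"
  and act_add: "act (g + h) x = act g (act h x)"
  using dyn by (auto simp: dyn_system_def)

lemma continuous_act: "continuous_on UNIV (act g)"
proof -
  have "continuous_on UNIV (\<lambda>(g, x). act g x)"
    using dyn by (simp add: dyn_system_def)
  then have "continuous_on UNIV (\<lambda>x. (case (g, x) of (g, x) \<Rightarrow> act g x))"
    by (rule continuous_on_compose2) (auto intro!: continuous_intros)
  then show ?thesis by simp
qed

lemma continuous_f_act:
  "continuous_on UNIV f \<Longrightarrow> continuous_on UNIV (\<lambda>x. f (act g x))"
  by (rule continuous_on_compose2[OF _ continuous_act]) auto

lemma bounded_cont:
  fixes f :: "'x \<Rightarrow> real"
  assumes "continuous_on UNIV f"
  obtains B where "B > 0" "\<And>x. \<bar>f x\<bar> \<le> B"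
proof -
  have "bounded (range f)"
    using compact_continuous_image[OF assms compact_UNIV] by (rule compact_imp_bounded)
  then show ?thesis using that by (metis bounded_pos rangeI real_norm_def)
qed

text \<open>Given coefficients \<open>c\<close>, let \<open>x\<close> have
  \<open>f (act s x)\<close> above \<open>b\<close> where \<open>c s\<close> is nonnegative and
  below \<open>a\<close> where it is negative, and let \<open>y\<close> have the opposite pattern.
  The values of the combination at \<open>x\<close> and \<open>y\<close> differ by at least
  \<open>b - a\<close> times the sum of the \<open>\<bar>c s\<bar>\<close>, so its norm is at least
  half of that: the translates form an l1-isomorphism set.\<close>

lemma no_infinite_independence_set:
  fixes f :: "'x \<Rightarrow> real"
  assumes f: "continuous_on UNIV f" and "a < b" and J: "infinite J"
    and ind: "\<And>F Q. finite F \<Longrightarrow> F \<subseteq> J \<Longrightarrow> Q \<subseteq> F \<Longrightarrow>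
      \<exists>x. (\<forall>s\<in>Q. f (act s x) > b) \<and> (\<forall>s\<in>F - Q. f (act s x) < a)"
  shows False
proof -
  obtain B where B: "B > 0" "\<And>x. \<bar>f x\<bar> \<le> B" using bounded_cont[OF f] by blast
  have "l1_isomorphism_set act f J"
    unfolding l1_isomorphism_set_def
  proof (rule exI[of _ "(b - a) / 2"], rule exI[of _ B], intro conjI allI impI)
    fix F c assume F: "finite F" "F \<subseteq> J"
    define h where "h x = (\<Sum>s\<in>F. c s * f (act s x))" for x
    have hB: "\<bar>h x\<bar> \<le> B * (\<Sum>s\<in>F. \<bar>c s\<bar>)" for x
      unfolding h_def sum_distrib_left
      by (rule order_trans[OF sum_abs sum_mono]) (auto simp: abs_mult mult.commute[of B] intro!: mult_left_mono B(2))
    show "sup_norm (\<lambda>x. \<Sum>s\<in>F. c s * f (act s x)) \<le> B * (\<Sum>s\<in>F. \<bar>c s\<bar>)"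
      unfolding sup_norm_def h_def[symmetric] using hB by (intro cSUP_least) auto
    have le: "\<bar>h x\<bar> \<le> sup_norm h" for x
      unfolding sup_norm_def using hB by (intro cSUP_upper bdd_aboveI2) auto
    obtain x where x: "\<And>s. s \<in> F \<Longrightarrow> c s \<ge> 0 \<Longrightarrow> f (act s x) > b" "\<And>s. s \<in> F \<Longrightarrow> c s < 0 \<Longrightarrow> f (act s x) < a"
      using ind[OF F, of "{s\<in>F. c s \<ge> 0}"] by (fastforce simp: not_le)
    obtain y where y: "\<And>s. s \<in> F \<Longrightarrow> c s < 0 \<Longrightarrow> f (act s y) > b" "\<And>s. s \<in> F \<Longrightarrow> c s \<ge> 0 \<Longrightarrow> f (act s y) < a"
      using ind[OF F, of "{s\<in>F. c s < 0}"] by (fastforce simp: not_less)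
    have "(b - a) * \<bar>c s\<bar> \<le> c s * (f (act s x) - f (act s y))" if "s \<in> F" for s
    proof (cases "c s \<ge> 0")
      case True
      then have "b - a \<le> f (act s x) - f (act s y)" using x(1)[of s] y(2)[of s] that by auto
      then show ?thesis using True by (simp add: mult_left_mono mult.commute)
    next
      case False
      then have "b - a \<le> f (act s y) - f (act s x)" using x(2)[of s] y(1)[of s] that by auto
      then have "(b - a) * - c s \<le> (f (act s y) - f (act s x)) * - c s"
        using False by (intro mult_right_mono) auto
      then show ?thesis using False by (simp add: algebra_simps)
    qed
    then have "(\<Sum>s\<in>F. (b - a) * \<bar>c s\<bar>) \<le> (\<Sum>s\<in>F. c s * (f (act s x) - f (act s y)))"
      by (rule sum_mono)
    also have "\<dots> = h x - h y"
      by (simp add: h_def right_diff_distrib sum_subtractf)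
    also have "\<dots> \<le> 2 * sup_norm h"
      using le[of x] le[of y] by linarith
    finally show "(b - a) / 2 * (\<Sum>s\<in>F. \<bar>c s\<bar>) \<le> sup_norm (\<lambda>x. \<Sum>s\<in>F. c s * f (act s x))"
      unfolding h_def[symmetric] by (simp add: sum_distrib_left[symmetric])
  qed (use \<open>a < b\<close> B in auto)
  with tame f J show False unfolding tame_system_def by blast
qed

section \<open>Total boundedness of the orbit of a level set\<close>

text \<open>The colour of \<open>s\<close> is a point of a finite \<open>\<epsilon> / 2\<close>-net
  for the pseudometric \<open>d\<close>, so equal colours mean distance below
  \<open>\<epsilon>\<close>. Without such a net a greedy choice gives an infinite separated set of
  translates, and \<open>independent_subset\<close> turns it into an independence set.\<close>

lemma finite_colouring:
  fixes f :: "'x \<Rightarrow> real"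
  assumes f: "continuous_on UNIV f" and m: "finadd m" and inv: "\<And>g Y. m (act g -` Y) = m Y"
    and level: "\<And>\<epsilon>. \<epsilon> > 0 \<Longrightarrow> \<exists>\<eta>>0. m {u. a - \<eta> \<le> f u \<and> f u \<le> a + \<eta>} < \<epsilon>"
    and "\<epsilon> > 0"
  obtains c :: "'g \<Rightarrow> 'g" where "finite (range c)"
    "\<And>s s'. c s = c s' \<Longrightarrow> m (sym_diff {u. f (act s u) < a} {u. f (act s' u) < a}) < \<epsilon>"
proof -
  interpret finadd m by fact
  define E where "E s = {u. f (act s u) < a}" for s
  define d where "d s s' = m (sym_diff (E s) (E s'))" for s s'
  have d_sym: "d s s' = d s' s" for s s' by (simp add: d_def Un_commute)
  have d_tri: "d s t \<le> d s r + d r t" for s r t unfolding d_def by (rule le_Un) auto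
  have "\<exists>R. finite R \<and> (\<forall>s. \<exists>r\<in>R. d s r < \<epsilon> / 2)"
  proof (rule ccontr)
    assume "\<not> ?thesis"
    then have far: "\<exists>s. \<forall>r\<in>R. d s r \<ge> \<epsilon> / 2" if "finite R" for R using that by (meson not_less)
    have d_self: "d s s = 0" for s by (simp add: d_def)
    obtain S where S: "infinite S"
      "\<And>F. finite F \<Longrightarrow> F \<subseteq> S \<Longrightarrow> \<exists>T. F \<subseteq> T \<and> (\<forall>s\<in>T. \<forall>r\<in>T. s \<noteq> r \<longrightarrow> d s r \<ge> \<epsilon> / 2)"
    proof (rule infinite_set_by_extension[of "\<lambda>T. \<forall>s\<in>T. \<forall>r\<in>T. s \<noteq> r \<longrightarrow> d s r \<ge> \<epsilon> / 2"])
      fix T :: "'g set" assume T: "finite T" "\<forall>s\<in>T. \<forall>r\<in>T. s \<noteq> r \<longrightarrow> d s r \<ge> \<epsilon> / 2"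
      obtain s where s: "\<forall>r\<in>T. d s r \<ge> \<epsilon> / 2" using far[OF T(1)] by blast
      have "s \<notin> T" using s d_self[of s] \<open>\<epsilon> > 0\<close> by force
      moreover have "d r s \<ge> \<epsilon> / 2" if "r \<in> T" for r using s that d_sym by metis
      ultimately show "\<exists>t. t \<notin> T \<and> (\<forall>s\<in>insert t T. \<forall>r\<in>insert t T. s \<noteq> r \<longrightarrow> d s r \<ge> \<epsilon> / 2)"
        using T(2) s by (intro exI[of _ s]) auto
    qed auto
    have sep: "d s r \<ge> \<epsilon> / 2" if "s \<in> S" "r \<in> S" "s \<noteq> r" for s r
      using S(2)[of "{s, r}"] that by auto
    \<comment> \<open>Independence needs a gap between the two levels. Discarding the windows
      \<open>N s\<close> and \<open>N r\<close> costs at most \<open>\<epsilon> / 8\<close>, so more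
      than \<open>\<epsilon> / 4\<close> of the separation \<open>\<epsilon> / 2\<close> remains for
      \<open>A\<close> and \<open>B\<close>.\<close>
    obtain \<eta> where \<eta>: "\<eta> > 0" "m {u. a - \<eta> \<le> f u \<and> f u \<le> a + \<eta>} < \<epsilon> / 16"
      using level[of "\<epsilon> / 16"] \<open>\<epsilon> > 0\<close> by auto
    define A B where "A s = {u. f (act s u) < a - \<eta>}" and "B s = {u. f (act s u) > a + \<eta>}" for s
    define N where "N s = {u. a - \<eta> \<le> f (act s u) \<and> f (act s u) \<le> a + \<eta>}" for s
    have N: "m (N s) < \<epsilon> / 16" for s
      using \<eta>(2) inv[of s "{u. a - \<eta> \<le> f u \<and> f u \<le> a + \<eta>}"] by (simp add: N_def vimage_def)
    have "m (A s \<inter> B r) + m (A r \<inter> B s) \<ge> \<epsilon> / 4" if "s \<in> S" "r \<in> S" "s \<noteq> r" for s r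
    proof -
      have "m (sym_diff (E s) (E r)) \<le> m (A s \<inter> B r \<union> A r \<inter> B s) + m (N s \<union> N r)"
        using \<eta>(1) by (intro le_Un) (auto simp: E_def A_def B_def N_def)
      with sep[OF that] N[of s] N[of r] subadditive[of "N s" "N r"] subadditive[of "A s \<inter> B r" "A r \<inter> B s"] \<open>\<epsilon> > 0\<close>
      show ?thesis unfolding d_def by linarith
    qed
    then obtain J where J: "infinite J"
      "\<And>F Q. finite F \<Longrightarrow> F \<subseteq> J \<Longrightarrow> Q \<subseteq> F \<Longrightarrow> (\<Inter>s\<in>Q. B s) \<inter> (\<Inter>s\<in>F - Q. A s) \<noteq> {}"
      using independent_subset[of S "\<epsilon> / 4" A B] S(1) \<open>\<epsilon> > 0\<close> by (metis divide_pos_pos zero_less_numeral)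
    show False
    proof (rule no_infinite_independence_set[OF f _ J(1)])
      show "a - \<eta> < a + \<eta>" using \<eta> by simp
      fix F Q assume "finite F" "F \<subseteq> J" "Q \<subseteq> F"
      from J(2)[OF this] have "\<exists>u. u \<in> (\<Inter>s\<in>Q. B s) \<inter> (\<Inter>s\<in>F - Q. A s)"
        by (simp only: ex_in_conv not_False_eq_True)
      then show "\<exists>x. (\<forall>s\<in>Q. f (act s x) > a + \<eta>) \<and> (\<forall>s\<in>F - Q. f (act s x) < a - \<eta>)"
        by (auto simp: A_def B_def)
    qed
  qed
  then obtain R where R: "finite R" "\<And>s. \<exists>r\<in>R. d s r < \<epsilon> / 2" by blast
  then obtain c where c: "\<And>s. c s \<in> R \<and> d s (c s) < \<epsilon> / 2" by metis
  have "finite (range c)" using R(1) c by (metis finite_subset image_subsetI)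
  moreover have "d s s' < \<epsilon>" if "c s = c s'" for s s'
    using c[of s] c[of s'] d_tri[of s s' "c s"] d_sym[of s' "c s"] that by auto
  ultimately show ?thesis using that unfolding d_def E_def by blast
qed

end

section \<open>Averages over lists of group elements\<close>

text \<open>Lists keep multiplicities, so translates and convolutions of averages are again averages
  of this form.\<close>

definition list_avg :: "'a list \<Rightarrow> ('a \<Rightarrow> real) \<Rightarrow> real" where
  "list_avg L \<phi> = (\<Sum>t\<leftarrow>L. \<phi> t) / real (length L)"

definition list_frac :: "'a list \<Rightarrow> 'a set \<Rightarrow> real" where
  "list_frac L P = list_avg L (indicator P)"

lemma list_avg_add: "list_avg L (\<lambda>t. \<phi> t + \<psi> t) = list_avg L \<phi> + list_avg L \<psi>"
  by (simp add: list_avg_def sum_list_addf add_divide_distrib)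

lemma list_avg_diff: "list_avg L (\<lambda>t. \<phi> t - \<psi> t) = list_avg L \<phi> - list_avg L \<psi>"
  by (simp add: list_avg_def sum_list_subtractf diff_divide_distrib)

lemma list_avg_cmult: "list_avg L (\<lambda>t. c * \<phi> t) = c * list_avg L \<phi>"
  by (simp add: list_avg_def sum_list_const_mult)

lemma list_avg_sum: "finite I \<Longrightarrow> list_avg L (\<lambda>t. \<Sum>i\<in>I. \<phi> i t) = (\<Sum>i\<in>I. list_avg L (\<phi> i))"
  by (induction I rule: finite_induct) (simp_all add: list_avg_add, simp add: list_avg_def)

lemma list_avg_const: "L \<noteq> [] \<Longrightarrow> list_avg L (\<lambda>_. c) = c"
  by (simp add: list_avg_def sum_list_triv)

lemma list_avg_mono: "(\<And>t. \<phi> t \<le> \<psi> t) \<Longrightarrow> list_avg L \<phi> \<le> list_avg L \<psi>"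
  by (simp add: list_avg_def divide_right_mono sum_list_mono)

lemma list_avg_abs_le:
  assumes "L \<noteq> []" "\<And>t. \<bar>\<phi> t\<bar> \<le> c"
  shows "\<bar>list_avg L \<phi>\<bar> \<le> c"
proof -
  have "list_avg L (\<lambda>_. - c) \<le> list_avg L \<phi>" "list_avg L \<phi> \<le> list_avg L (\<lambda>_. c)"
    using assms(2) by (auto intro!: list_avg_mono simp: abs_le_iff minus_le_iff)
  then show ?thesis by (simp add: list_avg_const[OF assms(1)] abs_le_iff)
qed

lemma list_avg_map: "list_avg (map g L) \<phi> = list_avg L (\<lambda>t. \<phi> (g t))"
  by (simp add: list_avg_def comp_def)

lemma continuous_on_list_avg:
  assumes "\<And>t. continuous_on A (\<phi> t)"
  shows "continuous_on A (\<lambda>u. list_avg L (\<lambda>t. \<phi> t u))"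
proof -
  have "continuous_on A (\<lambda>u. \<Sum>t\<leftarrow>L. \<phi> t u)"
    by (induction L) (simp_all add: assms continuous_on_add)
  then show ?thesis
    unfolding list_avg_def divide_inverse by (intro continuous_on_mult_right)
qed

lemma finadd_list_frac:
  assumes "L \<noteq> []"
  shows "finadd (list_frac L)"
proof
  show "0 \<le> list_frac L A" for A
    using list_avg_mono[of "\<lambda>_. 0" "indicator A" L] assms by (simp add: list_frac_def list_avg_const)
  show "list_frac L UNIV = 1"
    using assms by (simp add: list_frac_def list_avg_const)
  show "list_frac L (A \<union> B) = list_frac L A + list_frac L B" if "A \<inter> B = {}" for A B
    using that by (simp add: list_frac_def indicator_add list_avg_add[symmetric])
qed

lemma list_frac_pos_ex:
  assumes "list_frac L P > 0"
  shows "\<exists>t. t \<in> P"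
proof (rule ccontr)
  assume "\<not> ?thesis"
  then have "P = {}" by blast
  then show False using assms by (simp add: list_frac_def list_avg_def indicator_def)
qed

section \<open>Almost invariant averages on an abelian group\<close>

definition almost_inv :: "'g::ab_group_add list \<Rightarrow> 'g \<Rightarrow> real \<Rightarrow> bool" where
  "almost_inv L g \<eta> \<longleftrightarrow>
     (\<forall>\<phi>. (\<forall>t. 0 \<le> \<phi> t \<and> \<phi> t \<le> 1) \<longrightarrow> \<bar>list_avg L (\<lambda>t. \<phi> (t + g)) - list_avg L \<phi>\<bar> \<le> \<eta>)"

lemma almost_inv_list_frac:
  assumes "almost_inv L g \<eta>"
  shows "\<bar>list_frac L {t. t + g \<in> P} - list_frac L P\<bar> \<le> \<eta>"
proof -
  have "(\<lambda>t. indicat_real P (t + g)) = indicator {t. t + g \<in> P}"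
    by (auto simp: indicator_def)
  then show ?thesis
    using assms[unfolded almost_inv_def, rule_format, of "indicator P"] by (simp add: list_frac_def)
qed

text \<open>The test functions are all functions with values in [0,1], so a translate of a test
  function is again one.\<close>

lemma almost_inv_shift: "almost_inv L g \<eta> \<Longrightarrow> almost_inv (map (\<lambda>t. t + c) L) g \<eta>"
  unfolding almost_inv_def list_avg_map
proof (intro allI impI)
  fix \<phi> :: "'a \<Rightarrow> real"
  assume *: "\<forall>\<phi>. (\<forall>t. 0 \<le> \<phi> t \<and> \<phi> t \<le> 1) \<longrightarrow> \<bar>list_avg L (\<lambda>t. \<phi> (t + g)) - list_avg L \<phi>\<bar> \<le> \<eta>"
    and \<phi>: "\<forall>t. 0 \<le> \<phi> t \<and> \<phi> t \<le> 1"
  show "\<bar>list_avg L (\<lambda>t. \<phi> (t + c + g)) - list_avg L (\<lambda>t. \<phi> (t + c))\<bar> \<le> \<eta>"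
    using *[rule_format, of "\<lambda>t. \<phi> (t + c)"] \<phi> by (simp add: add_ac)
qed

text \<open>Along the progression 0, g, ..., (N-1)g the difference of the two averages telescopes to
  two boundary terms.\<close>

lemma almost_inv_multiples:
  assumes "N > 0"
  shows "almost_inv (map (\<lambda>n. ((+) g ^^ n) 0) [0..<N]) g (1 / real N)"
  unfolding almost_inv_def
proof (intro allI impI)
  fix \<phi> :: "'a \<Rightarrow> real" assume \<phi>: "\<forall>t. 0 \<le> \<phi> t \<and> \<phi> t \<le> 1"
  let ?g = "\<lambda>n. ((+) g ^^ n) 0"
  have "list_avg (map ?g [0..<N]) (\<lambda>t. \<phi> (t + g)) - list_avg (map ?g [0..<N]) \<phi>
      = list_avg [0..<N] (\<lambda>n. \<phi> (?g (Suc n)) - \<phi> (?g n))"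
    by (simp add: list_avg_map list_avg_diff add.commute)
  also have "\<dots> = (\<Sum>n<N. \<phi> (?g (Suc n)) - \<phi> (?g n)) / real N"
    by (simp add: list_avg_def interv_sum_list_conv_sum_set_nat atLeast0LessThan)
  also have "\<dots> = (\<phi> (?g N) - \<phi> (?g 0)) / real N"
    by (simp only: sum_lessThan_telescope[of "\<lambda>n. \<phi> (?g n)"])
  finally show "\<bar>list_avg (map ?g [0..<N]) (\<lambda>t. \<phi> (t + g)) - list_avg (map ?g [0..<N]) \<phi>\<bar> \<le> 1 / real N"
    using \<phi>[rule_format, of "?g N"] \<phi>[rule_format, of "?g 0"] by (auto simp: divide_right_mono abs_le_iff)
qed

definition list_conv :: "'g::ab_group_add list \<Rightarrow> 'g list \<Rightarrow> 'g list" where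
  "list_conv L M = concat (map (\<lambda>a. map ((+) a) M) L)"

lemma list_avg_conv: "list_avg (list_conv L M) \<phi> = list_avg L (\<lambda>a. list_avg M (\<lambda>b. \<phi> (a + b)))"
proof -
  have "(\<Sum>t\<leftarrow>list_conv L M. \<phi> t) = (\<Sum>a\<leftarrow>L. \<Sum>b\<leftarrow>M. \<phi> (a + b))"
    by (induction L) (simp_all add: list_conv_def comp_def)
  moreover have "length (list_conv L M) = length L * length M"
    by (induction L) (simp_all add: list_conv_def)
  moreover have "(\<Sum>a\<leftarrow>L. (\<Sum>b\<leftarrow>M. \<phi> (a + b)) / real (length M)) = (\<Sum>a\<leftarrow>L. \<Sum>b\<leftarrow>M. \<phi> (a + b)) / real (length M)"
    by (induction L) (simp_all add: add_divide_distrib)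
  ultimately show ?thesis
    by (simp add: list_avg_def)
qed

text \<open>Commutativity lets a shift by \<open>g\<close> be absorbed by either factor, so almost
  invariance of one factor is enough.\<close>

lemma almost_inv_conv:
  assumes ne: "L \<noteq> []" "M \<noteq> []" and inv: "almost_inv L g \<eta> \<or> almost_inv M g \<eta>"
  shows "almost_inv (list_conv L M) g \<eta>"
  unfolding almost_inv_def
proof (intro allI impI)
  fix \<phi> :: "'a \<Rightarrow> real" assume \<phi>: "\<forall>t. 0 \<le> \<phi> t \<and> \<phi> t \<le> 1"
  show "\<bar>list_avg (list_conv L M) (\<lambda>t. \<phi> (t + g)) - list_avg (list_conv L M) \<phi>\<bar> \<le> \<eta>"
    using inv
  proof
    assume inv: "almost_inv L g \<eta>"
    define H where "H a = list_avg M (\<lambda>b. \<phi> (a + b))" for a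
    have "0 \<le> H a \<and> H a \<le> 1" for a
      using list_avg_mono[of "\<lambda>_. 0" "\<lambda>b. \<phi> (a + b)" M] list_avg_mono[of "\<lambda>b. \<phi> (a + b)" "\<lambda>_. 1" M] \<phi>
      by (simp add: H_def list_avg_const[OF ne(2)])
    with inv have "\<bar>list_avg L (\<lambda>a. H (a + g)) - list_avg L H\<bar> \<le> \<eta>"
      by (simp add: almost_inv_def)
    then show ?thesis by (simp add: list_avg_conv H_def[abs_def] add_ac)
  next
    assume inv: "almost_inv M g \<eta>"
    have "\<bar>list_avg M (\<lambda>b. \<phi> (a + (b + g))) - list_avg M (\<lambda>b. \<phi> (a + b))\<bar> \<le> \<eta>" for a
      using inv[unfolded almost_inv_def, rule_format, of "\<lambda>b. \<phi> (a + b)"] \<phi> by simp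
    then show ?thesis
      unfolding list_avg_conv list_avg_diff[symmetric, of L]
      by (intro list_avg_abs_le[OF ne(1)]) (simp add: add_ac)
  qed
qed

text \<open>This is the amenability of abelian groups: convolving one long progression per
  requirement satisfies them all.\<close>

lemma almost_inv_exists:
  fixes X :: "('g::ab_group_add \<times> real) set"
  assumes "finite X" "\<And>g \<eta>. (g, \<eta>) \<in> X \<Longrightarrow> \<eta> > 0"
  obtains L :: "'g list" where "L \<noteq> []" "\<And>g \<eta>. (g, \<eta>) \<in> X \<Longrightarrow> almost_inv L g \<eta>"
proof -
  have "\<exists>L :: 'g list. L \<noteq> [] \<and> (\<forall>(g, \<eta>)\<in>X. almost_inv L g \<eta>)"
    using assms
  proof (induction X rule: finite_induct)
    case empty
    show ?case by (intro exI[of _ "[0]"]) simp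
  next
    case (insert p X)
    obtain g \<eta> where p: "p = (g, \<eta>)" by fastforce
    obtain L where L: "L \<noteq> []" "\<forall>(g, \<eta>)\<in>X. almost_inv L g \<eta>"
      using insert by auto
    obtain N where N: "inverse (real (Suc N)) < \<eta>"
      using insert.prems[of g \<eta>] p reals_Archimedean by blast
    let ?M = "map (\<lambda>n. ((+) g ^^ n) 0) [0..<Suc N]"
    have M: "?M \<noteq> []" by simp
    have "almost_inv ?M g (1 / real (Suc N))"
      by (rule almost_inv_multiples) simp
    then have "almost_inv ?M g \<eta>"
      using N unfolding almost_inv_def inverse_eq_divide by (meson less_imp_le order_trans)
    then have "almost_inv (list_conv L ?M) g \<eta>"
      by (intro almost_inv_conv[OF L(1) M]) blast
    moreover have "almost_inv (list_conv L ?M) g' \<eta>'" if "(g', \<eta>') \<in> X" for g' \<eta>'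
      using L that by (intro almost_inv_conv[OF L(1) M]) blast
    moreover have "list_conv L ?M \<noteq> []"
      using L(1) by (cases L) (simp_all add: list_conv_def)
    ultimately show ?case
      using p by (intro exI[of _ "list_conv L ?M"]) auto
  qed
  then show ?thesis using that by blast
qed

text \<open>The functions \<open>u \<mapsto> min u (v\<^sub>i + \<eta>) - min u v\<^sub>i\<close> sum to \<open>u - v\<^sub>0\<close>, so for one of them the
  averages along \<open>u\<close> and \<open>w - 2\<eta>\<close> differ; it is squeezed between multiples of two indicators.\<close>

lemma level_gap:
  fixes B :: real
  assumes "\<epsilon> > 0" "B > 0"
  obtains N :: nat and v :: "nat \<Rightarrow> real" and \<eta> \<delta> :: real where "\<eta> > 0" "\<delta> > 0"
    "\<And>(L :: 'a list) u w. L \<noteq> [] \<Longrightarrow> (\<And>t. \<bar>u t\<bar> \<le> B) \<Longrightarrow> (\<And>t. \<bar>w t\<bar> \<le> B) \<Longrightarrow>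
       list_avg L w - list_avg L u > \<epsilon> \<Longrightarrow>
       \<exists>i<N. list_frac L {t. u t < v i} + list_frac L {t. w t > v i + \<eta>} \<ge> 1 + \<delta>"
proof -
  \<comment> \<open>The levels \<open>V i\<close> climb in steps of \<open>\<eta>\<close> from
    \<open>- B - 2 * \<eta>\<close>, the least possible value of \<open>w t - 2 * \<eta>\<close>, up
    to at least \<open>B\<close>. Lowering \<open>w\<close> by \<open>2 * \<eta>\<close> uses up
    half of the gap \<open>\<epsilon>\<close>.\<close>
  define \<eta> where "\<eta> = \<epsilon> / 4"
  define N where "N = Suc (nat \<lceil>(2 * B + 2 * \<eta>) / \<eta>\<rceil>)"
  define V where "V i = - B - 2 * \<eta> + real i * \<eta>" for i
  have \<eta>: "\<eta> > 0" using assms by (simp add: \<eta>_def)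
  have "(2 * B + 2 * \<eta>) / \<eta> \<le> real N" unfolding N_def by linarith
  then have VN: "V N \<ge> B" using \<eta> by (simp add: V_def field_simps)
  have V0: "V 0 = - B - 2 * \<eta>" and VS: "V (Suc i) = V i + \<eta>" for i by (simp_all add: V_def algebra_simps)
  have N: "N > 0" by (simp add: N_def)
  define c where "c i u = min u (V (Suc i)) - min u (V i)" for i u
  have c_sum: "(\<Sum>i<N. c i u) = u - V 0" if "V 0 \<le> u" "u \<le> B" for u
    unfolding c_def by (subst sum_lessThan_telescope[of "\<lambda>i. min u (V i)"]) (use that VN in auto)
  show thesis
  proof (rule that[of \<eta> "2 / real N" N "\<lambda>i. V (Suc i)"])
    fix L :: "'a list" and u w :: "'a \<Rightarrow> real"
    assume L: "L \<noteq> []" and u: "\<And>t. \<bar>u t\<bar> \<le> B" and w: "\<And>t. \<bar>w t\<bar> \<le> B"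
      and gap: "list_avg L w - list_avg L u > \<epsilon>"
    interpret finadd "list_frac L" using L by (rule finadd_list_frac)
    let ?w = "\<lambda>t. w t - 2 * \<eta>"
    have "(\<Sum>i<N. list_avg L (\<lambda>t. c i (?w t)) - list_avg L (\<lambda>t. c i (u t)))
        = list_avg L (\<lambda>t. \<Sum>i<N. c i (?w t)) - list_avg L (\<lambda>t. \<Sum>i<N. c i (u t))"
      by (simp add: list_avg_sum sum_subtractf)
    also have "\<dots> = list_avg L (\<lambda>t. ?w t - V 0) - list_avg L (\<lambda>t. u t - V 0)"
    proof -
      have "(\<Sum>i<N. c i (?w t)) = ?w t - V 0" "(\<Sum>i<N. c i (u t)) = u t - V 0" for t
        using u[of t] w[of t] \<eta> by (intro c_sum; simp add: V0 abs_le_iff)+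
      then show ?thesis by simp
    qed
    also have "\<dots> = list_avg L w - list_avg L u - 2 * \<eta>"
      by (simp add: list_avg_diff list_avg_const[OF L])
    also have "\<dots> > \<epsilon> / 2" using gap by (simp add: \<eta>_def)
    finally have "\<epsilon> / 2 < (\<Sum>i<N. list_avg L (\<lambda>t. c i (?w t)) - list_avg L (\<lambda>t. c i (u t)))" .
    then have "\<exists>i<N. list_avg L (\<lambda>t. c i (?w t)) - list_avg L (\<lambda>t. c i (u t)) > \<epsilon> / 2 / real N"
      using sum_bounded_above[of "{..<N}" "\<lambda>i. list_avg L (\<lambda>t. c i (?w t)) - list_avg L (\<lambda>t. c i (u t))" "\<epsilon> / 2 / real N"] N
      by (fastforce simp: not_less)
    then obtain i where i: "i < N" "list_avg L (\<lambda>t. c i (?w t)) - list_avg L (\<lambda>t. c i (u t)) > \<epsilon> / 2 / real N"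
      by blast
    \<comment> \<open>The slice at \<open>w t - 2 * \<eta>\<close> vanishes unless
      \<open>w t > V i + 2 * \<eta>\<close>, which is \<open>V (Suc i) + \<eta>\<close>; the slice
      at \<open>u t\<close> is full once \<open>u t\<close> reaches \<open>V (Suc i)\<close>. The
      lowering of \<open>w\<close> thus becomes a gap \<open>\<eta>\<close> between the
      levels.\<close>
    have "list_avg L (\<lambda>t. c i (?w t)) \<le> list_avg L (\<lambda>t. \<eta> * indicator {t. w t > V (Suc i) + \<eta>} t)"
      using \<eta> by (intro list_avg_mono) (auto simp: c_def VS indicator_def)
    moreover have "list_avg L (\<lambda>t. c i (u t)) \<ge> list_avg L (\<lambda>t. \<eta> * indicator (- {t. u t < V (Suc i)}) t)"
      using \<eta> by (intro list_avg_mono) (auto simp: c_def VS indicator_def)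
    ultimately have "\<eta> * (list_frac L {t. w t > V (Suc i) + \<eta>} - list_frac L (- {t. u t < V (Suc i)})) > \<epsilon> / 2 / real N"
      using i(2) by (simp add: list_avg_cmult list_frac_def right_diff_distrib)
    moreover have "\<epsilon> / 2 / real N = \<eta> * (2 / real N)" by (simp add: \<eta>_def)
    ultimately have "list_frac L {t. w t > V (Suc i) + \<eta>} - (1 - list_frac L {t. u t < V (Suc i)}) > 2 / real N"
      using mult_less_cancel_left_pos[OF \<eta>] by (simp only: compl)
    then show "\<exists>i<N. list_frac L {t. u t < V (Suc i)} + list_frac L {t. w t > V (Suc i) + \<eta>} \<ge> 1 + 2 / real N"
      using i(1) by (intro exI[of _ i]) auto
  qed (use \<eta> N in auto)
qed

context tame_dynamics
begin

lemma minimal_hits: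
  assumes "minimal_system act" "open W" "x \<in> W"
  obtains g where "act g y \<in> W"
proof -
  have "x \<in> closure (range (\<lambda>g. act g y))"
    using assms(1) by (simp add: minimal_system_def)
  then show ?thesis using that assms(2,3) by (auto simp: closure_iff_nhds_not_empty)
qed

section \<open>Return times that are almost periods\<close>

text \<open>Pigeonhole on the partial sums of a sequence of successive returns \<open>j n = r n + h n\<close>, in
  which only the last summand \<open>h\<close> of a block stays generic.\<close>

lemma almost_period_return:
  fixes D :: "'g \<Rightarrow> real"
  assumes min: "minimal_system act" and V: "ultrafilter V" and y: "((\<lambda>h. act h x) \<longlongrightarrow> y) V"
    and c: "finite (range c)" "\<And>s s'. c s = c s' \<Longrightarrow> D (s - s') < \<epsilon>"
    and D_add: "\<And>s s'. D (s + s') \<le> D s + D s'"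
    and W: "open W" "x \<in> W"
  obtains r where "eventually (\<lambda>h. act (r + h) x \<in> W \<and> D (r + h) < 2 * \<epsilon>) V"
proof -
  \<comment> \<open>All shifts used below have this colour, so any two of them differ by an element
    of small \<open>D\<close>.\<close>
  obtain k where k: "eventually (\<lambda>h. c h = k) V"
    using ultrafilter_eventually_bex[OF V c(1), of "\<lambda>k h. c h = k"] by auto
  have ev: "eventually (\<lambda>h. act (r + h) x \<in> W') V" if "open W'" "act r y \<in> W'" for W' r
  proof -
    have "((\<lambda>h. act r (act h x)) \<longlongrightarrow> act r y) V"
      using continuous_on_tendsto_compose[OF continuous_act y] by simp
    then show ?thesis using that by (auto simp: act_add dest: topological_tendstoD)
  qed
  define P where "P W' r h \<longleftrightarrow> open W' \<and> x \<in> W' \<and> act r y \<in> W' \<and> c h = k \<and> act (r + h) x \<in> W'" for W' r h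
  have ex: "\<exists>r h. P W' r h" if W': "open W'" "x \<in> W'" for W'
  proof -
    obtain r where r: "act r y \<in> W'" using minimal_hits[OF min W'] by blast
    obtain h where "c h = k" "act (r + h) x \<in> W'"
      using eventually_happens[OF eventually_conj[OF k ev[OF W'(1) r]]] ultrafilter_not_bot[OF V] by auto
    with r W' show ?thesis by (auto simp: P_def)
  qed
  define P' where "P' n p \<longleftrightarrow> P (fst p) (fst (snd p)) (snd (snd p)) \<and> (n = 0 \<longrightarrow> fst p = W)" for n :: nat and p
  \<comment> \<open>The next neighbourhood consists of the points that the current return keeps
    inside the current one. Hence the sum of a block of consecutive returns from \<open>i\<close> to
    \<open>l\<close> carries the neighbourhood number \<open>l\<close> into number
    \<open>i\<close>.\<close>
  define next_nbhd where "next_nbhd p = fst p \<inter> act (fst (snd p) + snd (snd p)) -` fst p" for p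
  have "\<exists>q. \<forall>n. P' n (q n) \<and> fst (q (Suc n)) = next_nbhd (q n)"
  proof (rule dependent_nat_choice)
    show "\<exists>p. P' 0 p" using ex[OF W] by (auto simp: P'_def)
    fix p n assume p: "P' n p"
    have "open (next_nbhd p)" "x \<in> next_nbhd p"
      using p by (auto simp: P'_def P_def next_nbhd_def intro!: open_Int open_vimage continuous_act)
    from ex[OF this] show "\<exists>p'. P' (Suc n) p' \<and> fst p' = next_nbhd p"
      by (auto simp: P'_def)
  qed
  then obtain q where q: "\<And>n. P' n (q n)" "\<And>n. fst (q (Suc n)) = next_nbhd (q n)" by blast
  define w r h where "w n = fst (q n)" and "r n = fst (snd (q n))" and "h n = snd (snd (q n))" for n
  define j where "j n = r n + h n" for n
  have P: "P (w n) (r n) (h n)" and w0: "w 0 = W" and wS: "w (Suc n) = w n \<inter> act (j n) -` w n" for n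
    using q(1)[of n] q(1)[of 0] q(2)[of n] by (simp_all add: w_def r_def h_def j_def P'_def next_nbhd_def)
  have w_sub: "w n \<subseteq> W" for n
    by (induction n) (auto simp: w0 wS)
  have into: "act (\<Sum>n=i..<l. j n) u \<in> w i" if "i \<le> l" "u \<in> w l" for i l u
    using that
  proof (induction l arbitrary: u rule: dec_induct)
    case base
    then show ?case by simp
  next
    case (step l)
    then have "act (\<Sum>n=i..<l. j n) (act (j l) u) \<in> w i" by (auto simp: wS)
    then show ?case using step(1) by (simp add: act_add[symmetric])
  qed
  \<comment> \<open>Two partial sums of equal colour: the block between them is an almost
    period.\<close>
  have "\<not> inj (\<lambda>l. c (\<Sum>n<l. j n))"
  proof
    assume "inj (\<lambda>l. c (\<Sum>n<l. j n))"
    moreover have "finite (range (\<lambda>l. c (\<Sum>n<l. j n)))" using c(1) by (rule finite_subset[rotated]) auto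
    ultimately show False using finite_imageD by blast
  qed
  then obtain i l where il: "i < l" "c (\<Sum>n<l. j n) = c (\<Sum>n<i. j n)"
    unfolding inj_def by (metis linorder_neqE_nat)
  have "(\<Sum>n<l. j n) - (\<Sum>n<i. j n) = (\<Sum>n=i..<l. j n)"
    using il(1) by (simp add: sum_diff_nat_ivl[of 0 i l, symmetric] atLeast0LessThan)
  then have small: "D (\<Sum>n=i..<l. j n) < \<epsilon>" using c(2)[OF il(2)] by simp
  obtain p where p: "l = Suc p" "i \<le> p" using il(1) by (cases l) auto
  \<comment> \<open>The block sum is \<open>r' + h p\<close>. Replacing \<open>h p\<close> by
    another \<open>g\<close> of colour \<open>k\<close> adds \<open>g - h p\<close>, whose
    \<open>D\<close> is below \<open>\<epsilon>\<close>; with the block itself this makes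
    \<open>2 * \<epsilon>\<close>.\<close>
  define r' where "r' = (\<Sum>n=i..<p. j n) + r p"
  have "act r' y \<in> W"
    using into[OF p(2), of "act (r p) y"] P[of p] w_sub[of i] by (auto simp: r'_def act_add P_def)
  then have "eventually (\<lambda>h. act (r' + h) x \<in> W) V" by (rule ev[OF W(1)])
  with k have "eventually (\<lambda>h. act (r' + h) x \<in> W \<and> D (r' + h) < 2 * \<epsilon>) V"
  proof eventually_elim
    case (elim g)
    have "r' + g = (\<Sum>n=i..<l. j n) + (g - h p)"
      using p by (simp add: r'_def j_def)
    moreover have "D (g - h p) < \<epsilon>" using elim P[of p] by (intro c(2)) (simp add: P_def)
    ultimately have "D (r' + g) \<le> D (\<Sum>n=i..<l. j n) + D (g - h p)" and "D (g - h p) < \<epsilon>"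
      using D_add by metis+
    then have "D (r' + g) < 2 * \<epsilon>" using small by linarith
    then show ?case using elim by simp
  qed
  then show ?thesis by (rule that)
qed

section \<open>Averages with small oscillation\<close>

text \<open>If \<open>m1 {f < a} + m2 {f > b} > 1\<close> persists for all translates by a finite set \<open>S\<close>, some \<open>t\<close> has
  \<open>f (t s x) < a\<close> and \<open>f (t (s + e) x) > b\<close> for all \<open>s \<in> S\<close>; choosing \<open>e\<close> to be an almost period
  with \<open>e x\<close> near \<open>x\<close> preserves the inequality for \<open>S \<union> (S + e)\<close> and the patterns found so far.\<close>

lemma small_oscillation:
  fixes f :: "'x \<Rightarrow> real"
  assumes min: "minimal_system act" and f: "continuous_on UNIV f" and "\<epsilon> > 0"
  shows "\<exists>L. L \<noteq> [] \<and> (\<forall>x y. list_avg L (\<lambda>t. f (act t y)) - list_avg L (\<lambda>t. f (act t x)) \<le> \<epsilon>)"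
proof (rule ccontr)
  assume "\<not> ?thesis"
  then have osc: "\<exists>x y. list_avg L (\<lambda>t. f (act t y)) - list_avg L (\<lambda>t. f (act t x)) > \<epsilon>" if "L \<noteq> []" for L
    using that by (meson not_less)
  obtain B where B: "B > 0" "\<And>x. \<bar>f x\<bar> \<le> B" using bounded_cont[OF f] by blast
  fix x :: 'x
  define S where "S = (\<lambda>(g, \<eta>). {(L, h). L \<noteq> [] \<and> almost_inv L g \<eta> \<and>
    list_avg L (\<lambda>t. f (act (t + h) x)) - list_avg L (\<lambda>t. f (act t x)) > \<epsilon>})"
  obtain U where U: "ultrafilter U" "\<And>A. A \<in> S ` (UNIV \<times> {0<..}) \<Longrightarrow> eventually (\<lambda>i. i \<in> A) U"
  proof (rule ultrafilter_finite_intersections[of "S ` (UNIV \<times> {0<..})"])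
    fix Y assume "finite Y" "Y \<subseteq> S ` (UNIV \<times> {0<..})"
    then obtain X where X: "X \<subseteq> UNIV \<times> {0<..}" "finite X" "Y = S ` X"
      by (meson finite_subset_image)
    obtain L :: "'g list" where L: "L \<noteq> []" "\<And>g \<eta>. (g, \<eta>) \<in> X \<Longrightarrow> almost_inv L g \<eta>"
      using almost_inv_exists[OF X(2)] X(1) by auto
    define A where "A u = list_avg L (\<lambda>t. f (act t u))" for u
    have A: "continuous_on UNIV A"
      unfolding A_def[abs_def] by (intro continuous_on_list_avg continuous_f_act f)
    obtain u v where uv: "A v - A u > \<epsilon>" using osc[OF L(1)] unfolding A_def by blast
    \<comment> \<open>The threshold \<open>k\<close> leaves room on both sides, so
      \<open>A < k\<close> and \<open>A > k + \<epsilon>\<close> hold on nonempty open sets. By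
      minimality the orbit of \<open>x\<close> enters both, at \<open>g\<close> and
      \<open>g'\<close>; translating \<open>L\<close> by \<open>g\<close> and taking
      \<open>g' - g\<close> as shift moves the gap onto this one orbit.\<close>
    define k where "k = A u + (A v - A u - \<epsilon>) / 2"
    have "open (A -` {..<k})" "open (A -` {k + \<epsilon><..})" and u: "u \<in> A -` {..<k}" and v: "v \<in> A -` {k + \<epsilon><..}"
      using uv by (auto intro!: open_vimage A simp: k_def field_simps)
    then obtain g g' where "act g x \<in> A -` {..<k}" "act g' x \<in> A -` {k + \<epsilon><..}"
      by (metis minimal_hits[OF min])
    then have g: "A (act g x) < k" "A (act g' x) > k + \<epsilon>" by auto
    let ?L = "map (\<lambda>t. t + g) L" and ?h = "g' - g"
    have "list_avg ?L (\<lambda>t. f (act (t + ?h) x)) = A (act g' x)" "list_avg ?L (\<lambda>t. f (act t x)) = A (act g x)"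
      by (simp_all add: A_def list_avg_map act_add[symmetric])
    then have "(?L, ?h) \<in> \<Inter>Y"
      using L g by (auto simp: X(3) S_def intro!: almost_inv_shift)
    then show "\<Inter>Y \<noteq> {}" by blast
  qed blast
  have SU: "eventually (\<lambda>(L, h). L \<noteq> [] \<and> almost_inv L g \<eta> \<and>
      list_avg L (\<lambda>t. f (act (t + h) x)) - list_avg L (\<lambda>t. f (act t x)) > \<epsilon>) U" if "\<eta> > 0" for g \<eta>
    using U(2)[of "S (g, \<eta>)"] that by (auto simp: S_def)
  \<comment> \<open>The law of \<open>(t, h)\<close> with \<open>t\<close> drawn from the list
    \<open>L\<close> and \<open>h\<close> the shift attached to it. In the limit \<open>m\<close> it
    becomes exactly invariant in \<open>t\<close>, with \<open>h\<close> left untouched.\<close>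
  define \<nu> where "\<nu> = (\<lambda>(L, h) P. list_frac L ((\<lambda>t :: 'g. (t, h :: 'g)) -` P))"
  have "eventually (\<lambda>i. finadd (\<nu> i)) U"
    using SU[of 1 0] by (auto elim!: eventually_mono simp: \<nu>_def intro!: finadd.vimage finadd_list_frac)
  note lim = finadd_Lim[OF U(1) this]
  define m where "m P = Lim U (\<lambda>i. \<nu> i P)" for P
  interpret m: finadd m unfolding m_def[abs_def] by (rule lim(1))
  have m: "((\<lambda>i. \<nu> i P) \<longlongrightarrow> m P) U" for P unfolding m_def by (rule lim(2))
  note [simp] = ultrafilter_not_bot[OF U(1)]
  have m_inv: "m {(t, h). (t + g, h) \<in> P} = m P" for g P
  proof -
    have "\<bar>m {(t, h). (t + g, h) \<in> P} - m P\<bar> \<le> 0 + \<eta>" if "\<eta> > 0" for \<eta>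
    proof (rule tendsto_upperbound)
      show "((\<lambda>i. \<bar>\<nu> i {(t, h). (t + g, h) \<in> P} - \<nu> i P\<bar>) \<longlongrightarrow> \<bar>m {(t, h). (t + g, h) \<in> P} - m P\<bar>) U"
        by (intro tendsto_intros m)
      show "eventually (\<lambda>i. \<bar>\<nu> i {(t, h). (t + g, h) \<in> P} - \<nu> i P\<bar> \<le> 0 + \<eta>) U"
        using SU[OF that, of g]
      proof eventually_elim
        case (elim i)
        obtain L h where i: "i = (L, h)" by (cases i)
        then have "almost_inv L g \<eta>" using elim by simp
        from almost_inv_list_frac[OF this, of "(\<lambda>t. (t, h)) -` P"] show ?case
          by (simp add: \<nu>_def i vimage_def)
      qed
    qed simp
    then have "\<bar>m {(t, h). (t + g, h) \<in> P} - m P\<bar> \<le> 0" by (rule field_le_epsilon)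
    then show ?thesis by simp
  qed
  define p1 p2 where "p1 = (\<lambda>(t, h :: 'g). act t x)" and "p2 = (\<lambda>(t, h). act (t + h) x)"
  define m1 m2 where "m1 Y = m (p1 -` Y)" and "m2 Y = m (p2 -` Y)" for Y
  interpret m1: finadd m1 unfolding m1_def[abs_def] by (rule m.vimage)
  interpret m2: finadd m2 unfolding m2_def[abs_def] by (rule m.vimage)
  have m1_inv: "m1 (act g -` Y) = m1 Y" for g Y
    using m_inv[of g "p1 -` Y"] by (simp add: m1_def p1_def vimage_def case_prod_unfold act_add[symmetric] add_ac)
  have m2_inv: "m2 (act g -` Y) = m2 Y" for g Y
    using m_inv[of g "p2 -` Y"] by (simp add: m2_def p2_def vimage_def case_prod_unfold act_add[symmetric] add_ac)
  \<comment> \<open>The condition at \<open>b\<close> is phrased for \<open>- f\<close>, since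
    \<open>finite_colouring\<close> treats sublevel sets and \<open>f u > b\<close> means
    \<open>- f u < - b\<close>.\<close>
  obtain a b where "a < b" and ab: "m1 {u. f u < a} + m2 {u. f u > b} > 1"
    and a: "\<And>\<epsilon>. \<epsilon> > 0 \<Longrightarrow> \<exists>\<eta>>0. m1 {u. a - \<eta> \<le> f u \<and> f u \<le> a + \<eta>} < \<epsilon>"
    and b: "\<And>\<epsilon>. \<epsilon> > 0 \<Longrightarrow> \<exists>\<eta>>0. m2 {u. - b - \<eta> \<le> - f u \<and> - f u \<le> - b + \<eta>} < \<epsilon>"
  proof -
    obtain N :: nat and v :: "nat \<Rightarrow> real" and \<eta> \<delta> where \<eta>: "\<eta> > 0" "\<delta> > 0"
      and gap: "\<And>(L :: 'g list) u w. L \<noteq> [] \<Longrightarrow> (\<And>t. \<bar>u t\<bar> \<le> B) \<Longrightarrow> (\<And>t. \<bar>w t\<bar> \<le> B) \<Longrightarrow>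
       list_avg L w - list_avg L u > \<epsilon> \<Longrightarrow>
       \<exists>i<N. list_frac L {t. u t < v i} + list_frac L {t. w t > v i + \<eta>} \<ge> 1 + \<delta>"
      using level_gap[OF \<open>\<epsilon> > 0\<close> B(1), where 'a = 'g] by metis
    have "eventually (\<lambda>i. \<exists>k\<in>{..<N}. \<nu> i (p1 -` {u. f u < v k}) + \<nu> i (p2 -` {u. f u > v k + \<eta>}) \<ge> 1 + \<delta>) U"
      using SU[OF zero_less_one, of 0]
    proof eventually_elim
      case (elim i)
      obtain L h where i: "i = (L, h)" by (cases i)
      have "\<exists>i<N. list_frac L {t. f (act t x) < v i} + list_frac L {t. f (act (t + h) x) > v i + \<eta>} \<ge> 1 + \<delta>"
        using elim i B(2) by (intro gap) auto
      then show ?case by (auto simp: i \<nu>_def p1_def p2_def vimage_def)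
    qed
    from ultrafilter_eventually_bex[OF U(1) finite_lessThan this]
    obtain k where k: "eventually (\<lambda>i. \<nu> i (p1 -` {u. f u < v k}) + \<nu> i (p2 -` {u. f u > v k + \<eta>}) \<ge> 1 + \<delta>) U"
      by blast
    have "1 + \<delta> \<le> m1 {u. f u < v k} + m2 {u. f u > v k + \<eta>}"
      unfolding m1_def m2_def by (rule tendsto_lowerbound[OF tendsto_add[OF m m] k]) simp
    \<comment> \<open>The gap from \<open>v k\<close> to \<open>v k + \<eta>\<close> is halved:
      \<open>a\<close> lies in the lower half and \<open>- b'\<close> in the upper one, which gives
      \<open>a < b\<close> and only enlarges both events.\<close>
    moreover obtain a where a: "v k < a" "a < v k + \<eta> / 2"
      "\<And>\<epsilon>. \<epsilon> > 0 \<Longrightarrow> \<exists>\<eta>>0. m1 {u. a - \<eta> \<le> f u \<and> f u \<le> a + \<eta>} < \<epsilon>"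
      by (rule m1.continuity_level[of "v k" "v k + \<eta> / 2" f]) (use \<eta> in auto)
    moreover obtain b' where b: "- v k - \<eta> < b'" "b' < - v k - \<eta> / 2"
      "\<And>\<epsilon>. \<epsilon> > 0 \<Longrightarrow> \<exists>\<eta>>0. m2 {u. b' - \<eta> \<le> - f u \<and> - f u \<le> b' + \<eta>} < \<epsilon>"
      by (rule m2.continuity_level[of "- v k - \<eta>" "- v k - \<eta> / 2" "\<lambda>u. - f u"]) (use \<eta> in auto)
    moreover have "m1 {u. f u < v k} \<le> m1 {u. f u < a}" using a by (intro m1.mono) auto
    moreover have "m2 {u. f u > v k + \<eta>} \<le> m2 {u. f u > - b'}" using b by (intro m2.mono) auto
    ultimately show ?thesis using \<eta> by (intro that[of a "- b'"]) auto
  qed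
  define E F where "E s = {u. f (act s u) < a}" and "F s = {u. f (act s u) > b}" for s
  \<comment> \<open>By invariance of \<open>m1\<close> and \<open>m2\<close> this measures, at
    \<open>s - s'\<close>, how far the translates by \<open>s\<close> and \<open>s'\<close> differ
    in both events together; hence it is subadditive.\<close>
  define D where "D s = m1 (sym_diff (E s) (E 0)) + m2 (sym_diff (F s) (F 0))" for s
  have shift: "m1 (sym_diff (E (s + g)) (E (s' + g))) = m1 (sym_diff (E s) (E s'))"
    "m2 (sym_diff (F (s + g)) (F (s' + g))) = m2 (sym_diff (F s) (F s'))" for s s' g
    using m1_inv[of g "sym_diff (E s) (E s')"] m2_inv[of g "sym_diff (F s) (F s')"]
    by (simp_all add: E_def F_def act_add vimage_def set_diff_eq Un_def)
  have D_diff: "D (s - s') = m1 (sym_diff (E s) (E s')) + m2 (sym_diff (F s) (F s'))" for s s'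
    using shift[of "s - s'" s' 0] by (simp add: D_def)
  have D_add: "D (s + s') \<le> D s + D s'" for s s'
  proof -
    have "m1 (sym_diff (E (s + s')) (E 0)) \<le> m1 (sym_diff (E (s + s')) (E (0 + s'))) + m1 (sym_diff (E s') (E 0))"
      "m2 (sym_diff (F (s + s')) (F 0)) \<le> m2 (sym_diff (F (s + s')) (F (0 + s'))) + m2 (sym_diff (F s') (F 0))"
      by (intro m1.le_Un m2.le_Un; auto)+
    then show ?thesis unfolding shift D_def by linarith
  qed
  \<comment> \<open>What holds along \<open>V\<close> holds for the shift component along
    \<open>U\<close>, so it can be combined with events that have positive \<open>m\<close>.\<close>
  define V where "V = filtermap snd U"
  have V: "ultrafilter V" unfolding V_def using U(1) by (rule ultrafilter_filtermap)
  obtain y where y: "((\<lambda>h. act h x) \<longlongrightarrow> y) V"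
    using ultrafilter_compact_limit[OF V compact_UNIV, of "\<lambda>h. act h x"] by auto
  have return: "\<exists>r. eventually (\<lambda>h. act (r + h) x \<in> W \<and> D (r + h) < \<epsilon>') V"
    if W: "open W" "x \<in> W" and "\<epsilon>' > 0" for W \<epsilon>'
  proof -
    obtain c1 :: "'g \<Rightarrow> 'g" where c1: "finite (range c1)" "\<And>s s'. c1 s = c1 s' \<Longrightarrow> m1 (sym_diff (E s) (E s')) < \<epsilon>' / 4"
      using finite_colouring[OF f m1.finadd_axioms m1_inv a, of "\<epsilon>' / 4"] \<open>\<epsilon>' > 0\<close> unfolding E_def by auto
    have F_alt: "F s = {u. - f (act s u) < - b}" for s by (simp add: F_def)
    obtain c2 :: "'g \<Rightarrow> 'g" where c2: "finite (range c2)" "\<And>s s'. c2 s = c2 s' \<Longrightarrow> m2 (sym_diff (F s) (F s')) < \<epsilon>' / 4"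
      using finite_colouring[OF continuous_on_minus[OF f] m2.finadd_axioms m2_inv b, of "\<epsilon>' / 4"] \<open>\<epsilon>' > 0\<close>
      unfolding F_alt by auto
    \<comment> \<open>The joint colour controls both events: twice \<open>\<epsilon>' / 4\<close> is
      \<open>\<epsilon>' / 2\<close>, which \<open>almost_period_return\<close> doubles to
      \<open>\<epsilon>'\<close>.\<close>
    have fin: "finite (range (\<lambda>s. (c1 s, c2 s)))"
      by (rule finite_subset[OF _ finite_cartesian_product[OF c1(1) c2(1)]]) auto
    have close: "D (s - s') < \<epsilon>' / 2" if "(c1 s, c2 s) = (c1 s', c2 s')" for s s'
      using c1(2)[of s s'] c2(2)[of s s'] that unfolding D_diff by auto
    obtain r where "eventually (\<lambda>h. act (r + h) x \<in> W \<and> D (r + h) < 2 * (\<epsilon>' / 2)) V"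
      using almost_period_return[OF min V y fin close D_add W] by blast
    then show ?thesis by auto
  qed
  define pattern where "pattern T s Q \<longleftrightarrow> (\<forall>t\<in>Q. f (act (t + s) x) > b) \<and> (\<forall>t\<in>T - Q. f (act (t + s) x) < a)" for T s Q
  \<comment> \<open>The points \<open>act s x\<close> with \<open>s\<close> in \<open>S\<close>
    realise every pattern on \<open>T\<close>, while the excess over 1 guarantees a further time at
    which all of them are low and their shifted copies high.\<close>
  define Inv where "Inv T \<longleftrightarrow> (\<exists>S. finite S \<and> m1 (\<Inter>s\<in>S. E s) + m2 (\<Inter>s\<in>S. F s) > 1 \<and>
    (\<forall>Q\<subseteq>T. \<exists>s\<in>S. pattern T s Q))" for T
  obtain J where J: "infinite J" "\<And>F. finite F \<Longrightarrow> F \<subseteq> J \<Longrightarrow> \<exists>T. F \<subseteq> T \<and> Inv T"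
  proof (rule infinite_set_by_extension[of Inv])
    show "Inv {}" using ab by (auto simp: Inv_def pattern_def E_def F_def intro!: exI[of _ "{0}"])
    fix T assume T: "finite T" "Inv T"
    then obtain S where S: "finite S" "m1 (\<Inter>s\<in>S. E s) + m2 (\<Inter>s\<in>S. F s) > 1"
      "\<And>Q. Q \<subseteq> T \<Longrightarrow> \<exists>s\<in>S. pattern T s Q" by (auto simp: Inv_def)
    \<comment> \<open>On \<open>W\<close> all strict inequalities that hold at \<open>x\<close> at
      the times \<open>t + s\<close> persist, so a return of \<open>x\<close> to \<open>W\<close>
      preserves the old patterns.\<close>
    define W where "W = (\<Inter>(t, s)\<in>T \<times> S. (if f (act (t + s) x) < a then {u. f (act (t + s) u) < a} else UNIV) \<inter>
        (if f (act (t + s) x) > b then {u. f (act (t + s) u) > b} else UNIV))"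
    have "open W"
      unfolding W_def using T(1) S(1)
      by (intro open_INT finite_cartesian_product) (auto intro!: open_Int open_Collect_less continuous_f_act f continuous_on_const)
    have "x \<in> W" by (auto simp: W_def)
    \<comment> \<open>Passing to \<open>S \<union> (S + e)\<close> loses at most
      \<open>card S\<close> times \<open>D e\<close>. Dividing the excess by
      \<open>Suc (card S)\<close> keeps the loss strictly below it.\<close>
    define \<gamma> where "\<gamma> = (m1 (\<Inter>s\<in>S. E s) + m2 (\<Inter>s\<in>S. F s) - 1) / real (Suc (card S))"
    have "\<gamma> > 0" using S(2) by (simp add: \<gamma>_def)
    then obtain r where r: "eventually (\<lambda>h. act (r + h) x \<in> W \<and> D (r + h) < \<gamma>) V"
      using return[OF \<open>open W\<close> \<open>x \<in> W\<close>] by blast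
    \<comment> \<open>Invariance of \<open>m\<close> in \<open>t\<close> absorbs the fixed
      \<open>r\<close>, so the two events have probabilities with sum above 1 and must overlap.
      Positive limit mass then yields an actual \<open>t\<close> for a single pair of list and
      shift.\<close>
    define P where "P = {(t, h :: 'g). \<forall>s\<in>S. f (act (t + s) x) < a} \<inter> {(t, h). \<forall>s\<in>S. f (act (t + r + h + s) x) > b}"
    have "m {(t, h :: 'g). \<forall>s\<in>S. f (act (t + s) x) < a} = m1 (\<Inter>s\<in>S. E s)"
      by (auto simp: m1_def p1_def E_def act_add[symmetric] add_ac intro!: arg_cong[of _ _ m])
    moreover have "m {(t, h). \<forall>s\<in>S. f (act (t + r + h + s) x) > b} = m2 (\<Inter>s\<in>S. F s)"
      unfolding m2_def m_inv[of r "p2 -` (\<Inter>s\<in>S. F s)", symmetric]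
      by (auto simp: p2_def F_def act_add[symmetric] add_ac intro!: arg_cong[of _ _ m])
    ultimately have "m P > 0"
      unfolding P_def using m.Int_ge[of "{(t, h :: 'g). \<forall>s\<in>S. f (act (t + s) x) < a}"
        "{(t, h). \<forall>s\<in>S. f (act (t + r + h + s) x) > b}"] S(2) by linarith
    then have "eventually (\<lambda>i. \<nu> i P > 0) U" by (rule order_tendstoD(1)[OF m])
    moreover have "eventually (\<lambda>i. act (r + snd i) x \<in> W \<and> D (r + snd i) < \<gamma>) U"
      using r by (simp add: V_def eventually_filtermap)
    ultimately have "eventually (\<lambda>i. \<nu> i P > 0 \<and> act (r + snd i) x \<in> W \<and> D (r + snd i) < \<gamma>) U"
      by eventually_elim simp
    then obtain i where i: "\<nu> i P > 0" "act (r + snd i) x \<in> W" "D (r + snd i) < \<gamma>"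
      by (auto dest!: eventually_happens)
    obtain L h where Lh: "i = (L, h)" by (cases i)
    obtain t where "(t, h) \<in> P" using list_frac_pos_ex i(1) unfolding \<nu>_def Lh by fastforce
    define e where "e = r + h"
    have t: "\<And>s. s \<in> S \<Longrightarrow> f (act (t + s) x) < a" "\<And>s. s \<in> S \<Longrightarrow> f (act (t + (s + e)) x) > b"
      using \<open>(t, h) \<in> P\<close> by (auto simp: P_def e_def add_ac)
    have e: "act e x \<in> W" "D e < \<gamma>" using i by (simp_all add: Lh e_def)
    have "t \<notin> T"
    proof
      assume "t \<in> T"
      obtain s where "s \<in> S" "pattern T s T" using S(3)[of T] by blast
      with \<open>t \<in> T\<close> t(1)[of s] \<open>a < b\<close> show False by (auto simp: pattern_def)
    qed
    have keep: "pattern T (s + e) Q" if "s \<in> S" "Q \<subseteq> T" "pattern T s Q" for s Q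
    proof -
      have "f (act (t' + s) (act e x)) > b" if "t' \<in> Q" for t'
        using e(1) that \<open>s \<in> S\<close> \<open>Q \<subseteq> T\<close> \<open>pattern T s Q\<close> unfolding W_def pattern_def by (auto split: if_splits)
      moreover have "f (act (t' + s) (act e x)) < a" if "t' \<in> T - Q" for t'
        using e(1) that \<open>s \<in> S\<close> \<open>pattern T s Q\<close> unfolding W_def pattern_def by (auto split: if_splits)
      ultimately show ?thesis by (simp add: pattern_def act_add[symmetric] add_ac)
    qed
    let ?S = "S \<union> (\<lambda>s. s + e) ` S"
    have "m1 (\<Inter>s\<in>?S. E s) + m2 (\<Inter>s\<in>?S. F s) > 1"
    proof -
      have "m1 (\<Inter>s\<in>S. E s) \<le> m1 (\<Inter>s\<in>?S. E s) + m1 (\<Union>s\<in>S. sym_diff (E (s + e)) (E s))"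
        by (rule m1.le_Un) auto
      moreover have "m1 (\<Union>s\<in>S. sym_diff (E (s + e)) (E s)) \<le> (\<Sum>s\<in>S. m1 (sym_diff (E e) (E 0)))"
        using m1.subadditive_UN[OF S(1), of "\<lambda>s. sym_diff (E (s + e)) (E s)"] shift(1)[of e _ 0]
        by (simp add: add.commute)
      moreover have "m2 (\<Inter>s\<in>S. F s) \<le> m2 (\<Inter>s\<in>?S. F s) + m2 (\<Union>s\<in>S. sym_diff (F (s + e)) (F s))"
        by (rule m2.le_Un) auto
      moreover have "m2 (\<Union>s\<in>S. sym_diff (F (s + e)) (F s)) \<le> (\<Sum>s\<in>S. m2 (sym_diff (F e) (F 0)))"
        using m2.subadditive_UN[OF S(1), of "\<lambda>s. sym_diff (F (s + e)) (F s)"] shift(2)[of e _ 0]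
        by (simp add: add.commute)
      ultimately have "m1 (\<Inter>s\<in>?S. E s) + m2 (\<Inter>s\<in>?S. F s) \<ge> m1 (\<Inter>s\<in>S. E s) + m2 (\<Inter>s\<in>S. F s) - real (card S) * D e"
        by (simp add: D_def distrib_left)
      moreover have "real (card S) * D e \<le> real (card S) * \<gamma>"
        using e(2) by (intro mult_left_mono) auto
      moreover have "real (card S) * \<gamma> < real (Suc (card S)) * \<gamma>"
        using \<open>\<gamma> > 0\<close> by simp
      moreover have "real (Suc (card S)) * \<gamma> = m1 (\<Inter>s\<in>S. E s) + m2 (\<Inter>s\<in>S. F s) - 1"
        unfolding \<gamma>_def by simp
      ultimately show ?thesis by linarith
    qed
    \<comment> \<open>At the new time \<open>t\<close> the elements of \<open>S\<close> give values
      below \<open>a\<close>, their translates by \<open>e\<close> values above \<open>b\<close>; so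
      each old pattern extends both ways.\<close>
    moreover have "\<exists>s\<in>?S. pattern (insert t T) s Q" if Q: "Q \<subseteq> insert t T" for Q
    proof -
      obtain s where s: "s \<in> S" "pattern T s (Q - {t})" using S(3)[of "Q - {t}"] Q by auto
      show ?thesis
      proof (cases "t \<in> Q")
        case True
        have "pattern (insert t T) (s + e) Q"
          using keep[OF s(1) _ s(2)] Q t(2)[OF s(1)] True unfolding pattern_def by auto
        with s(1) show ?thesis by blast
      next
        case False
        then have "pattern (insert t T) s Q"
          using s t(1)[OF s(1)] unfolding pattern_def by auto
        with s(1) show ?thesis by blast
      qed
    qed
    ultimately have "Inv (insert t T)"
      using S(1) unfolding Inv_def by (intro exI[of _ ?S]) auto
    with \<open>t \<notin> T\<close> show "\<exists>t. t \<notin> T \<and> Inv (insert t T)" by blast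
  qed blast
  show False
  proof (rule no_infinite_independence_set[OF f \<open>a < b\<close> J(1)])
    fix K Q assume K: "finite K" "K \<subseteq> J" "Q \<subseteq> K"
    obtain T where "K \<subseteq> T" "Inv T" using J(2)[OF K(1,2)] by blast
    then obtain s where "pattern T s Q" using K(3) unfolding Inv_def by blast
    then show "\<exists>u. (\<forall>s\<in>Q. f (act s u) > b) \<and> (\<forall>s\<in>K - Q. f (act s u) < a)"
      using \<open>K \<subseteq> T\<close> by (intro exI[of _ "act s x"]) (auto simp: pattern_def act_add[symmetric])
  qed
qed

end

section \<open>The Radon measure induced by a finitely additive probability\<close>

text \<open>The classical route from a content to a regular measure: open sets are approximated by
  compact sets from inside, arbitrary sets by open sets from outside. Only values of
  \<open>m\<close> on compact sets enter.\<close>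

definition open_content :: "('x::topological_space set \<Rightarrow> real) \<Rightarrow> 'x set \<Rightarrow> real" where
  "open_content m U = (SUP K\<in>{K. compact K \<and> K \<subseteq> U}. m K)"

definition outer_content :: "('x::topological_space set \<Rightarrow> real) \<Rightarrow> 'x set \<Rightarrow> real" where
  "outer_content m A = (INF U\<in>{U. open U \<and> A \<subseteq> U}. open_content m U)"

lemma Hausdorff_space_t2: "Hausdorff_space (euclidean :: 'x::t2_space topology)"
  unfolding Hausdorff_space_def disjnt_def open_openin[symmetric] using hausdorff by blast

text \<open>The disjoint compact sets \<open>K - A\<close> and \<open>K - B\<close> have disjoint
  open neighbourhoods; removing one or the other from \<open>K\<close> leaves the two parts.\<close>

lemma compact_split:
  fixes K :: "'x::t2_space set"
  assumes "compact K" "open A" "open B" "K \<subseteq> A \<union> B"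
  obtains K1 K2 where "compact K1" "compact K2" "K1 \<subseteq> A" "K2 \<subseteq> B" "K = K1 \<union> K2"
proof -
  have "compact (K - A)" "compact (K - B)" using assms by (auto intro: compact_diff)
  moreover have "disjnt (K - A) (K - B)" using assms(4) by (auto simp: disjnt_iff)
  ultimately have "\<exists>P Q. open P \<and> open Q \<and> K - A \<subseteq> P \<and> K - B \<subseteq> Q \<and> disjnt P Q"
    using iffD1[OF Hausdorff_space_compact_sets Hausdorff_space_t2, rule_format, of "K - A" "K - B"]
    by (simp only: compactin_euclidean_iff open_openin[symmetric] simp_thms)
  then obtain P Q where PQ: "open P" "open Q" "K - A \<subseteq> P" "K - B \<subseteq> Q" "disjnt P Q"
    by (elim exE conjE)
  show ?thesis
  proof (rule that[of "K - P" "K - Q"])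
    show "compact (K - P)" "compact (K - Q)" using assms(1) PQ by (auto intro: compact_diff)
    show "K - P \<subseteq> A" "K - Q \<subseteq> B" "K = (K - P) \<union> (K - Q)" using PQ by (auto simp: disjnt_iff)
  qed
qed

locale compact_content = finadd m for m :: "'x::t2_space set \<Rightarrow> real" +
  assumes compact_space: "compact (UNIV :: 'x set)"
begin

abbreviation "v \<equiv> open_content m"
abbreviation "\<mu> \<equiv> outer_content m"

lemma bdd_v: "bdd_above (m ` {K. compact K \<and> K \<subseteq> U})"
  by (rule bdd_aboveI2[of _ _ 1]) (rule le_one)

lemma le_v: "compact K \<Longrightarrow> K \<subseteq> U \<Longrightarrow> m K \<le> v U"
  unfolding open_content_def by (intro cSUP_upper bdd_v) simp

lemma v_le: "(\<And>K. compact K \<Longrightarrow> K \<subseteq> U \<Longrightarrow> m K \<le> c) \<Longrightarrow> v U \<le> c"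
  unfolding open_content_def by (intro cSUP_least) auto

lemma v_nonneg: "0 \<le> v U"
  using le_v[of "{}" U] by simp

lemma v_mono: "U \<subseteq> W \<Longrightarrow> v U \<le> v W"
  by (intro v_le le_v) auto

lemma less_v_ex:
  assumes "c < v U"
  obtains K where "compact K" "K \<subseteq> U" "c < m K"
  using assms less_cSUP_iff[OF _ bdd_v, of U c] unfolding open_content_def by auto

lemma bdd_\<mu>: "bdd_below (v ` {U. open U \<and> A \<subseteq> U})"
  by (rule bdd_belowI2[of _ 0]) (rule v_nonneg)

lemma \<mu>_le: "open U \<Longrightarrow> A \<subseteq> U \<Longrightarrow> \<mu> A \<le> v U"
  unfolding outer_content_def by (intro cINF_lower bdd_\<mu>) simp

lemma le_\<mu>: "(\<And>U. open U \<Longrightarrow> A \<subseteq> U \<Longrightarrow> c \<le> v U) \<Longrightarrow> c \<le> \<mu> A"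
  unfolding outer_content_def by (intro cINF_greatest) auto

lemma \<mu>_nonneg: "0 \<le> \<mu> A"
  by (intro le_\<mu> v_nonneg)

lemma \<mu>_mono: "A \<subseteq> B \<Longrightarrow> \<mu> A \<le> \<mu> B"
  by (intro le_\<mu> \<mu>_le) auto

lemma \<mu>_open: "open U \<Longrightarrow> \<mu> U = v U"
  by (intro antisym \<mu>_le le_\<mu> v_mono) auto

lemma \<mu>_less_ex:
  assumes "\<mu> A < c"
  obtains U where "open U" "A \<subseteq> U" "v U < c"
proof -
  have "{U. open U \<and> A \<subseteq> U} \<noteq> {}" using open_UNIV by blast
  from cINF_less_iff[OF this bdd_\<mu>, of c] assms that show ?thesis
    unfolding outer_content_def by auto
qed

lemma content_le_sum_v:
  fixes U :: "nat \<Rightarrow> 'x set"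
  assumes "compact K" "\<And>i. open (U i)" "K \<subseteq> (\<Union>i<n. U i)"
  shows "m K \<le> (\<Sum>i<n. v (U i))"
  using assms(1,3)
proof (induction n arbitrary: K)
  case (Suc n)
  obtain K1 K2 where K: "compact K1" "compact K2" "K1 \<subseteq> (\<Union>i<n. U i)" "K2 \<subseteq> U n" "K = K1 \<union> K2"
    by (rule compact_split[OF Suc.prems(1), of "\<Union>i<n. U i" "U n"])
      (use Suc.prems(2) assms(2) in \<open>auto simp: lessThan_Suc\<close>)
  have "m K \<le> m K1 + m K2" using K(5) subadditive by simp
  also have "\<dots> \<le> (\<Sum>i<n. v (U i)) + v (U n)"
    using K by (intro add_mono Suc.IH le_v)
  finally show ?case by simp
qed simp

text \<open>Countable subadditivity comes from compactness: each compact subset of the union needs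
  finitely many of the sets, and finite additivity of \<open>m\<close> handles those.\<close>

lemma v_countably_subadditive:
  fixes U :: "nat \<Rightarrow> 'x set"
  assumes "\<And>i. open (U i)"
  shows "ennreal (v (\<Union>i. U i)) \<le> (\<Sum>i. ennreal (v (U i)))"
proof (rule ccontr)
  assume less: "\<not> ?thesis"
  then obtain c where c: "(\<Sum>i. ennreal (v (U i))) = ennreal c" "0 \<le> c"
    by (metis ennreal_cases not_less top_greatest)
  with less have "c < v (\<Union>i. U i)" by (simp add: not_le ennreal_less_iff)
  then obtain K where K: "compact K" "K \<subseteq> (\<Union>i. U i)" "c < m K" by (rule less_v_ex)
  obtain I where I: "finite I" "K \<subseteq> (\<Union>i\<in>I. U i)"
    using compactE_image[OF K(1), of UNIV U] assms K(2) by auto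
  then obtain n where "I \<subseteq> {..<n}" using finite_nat_iff_bounded by auto
  with I have "K \<subseteq> (\<Union>i<n. U i)" by blast
  from content_le_sum_v[OF K(1) assms this] have "ennreal (m K) \<le> (\<Sum>i<n. ennreal (v (U i)))"
    by (simp add: sum_ennreal v_nonneg ennreal_leI)
  also have "\<dots> \<le> (\<Sum>i. ennreal (v (U i)))" by (rule sum_le_suminf) auto
  finally show False using K(3) c by (simp add: ennreal_le_iff)
qed

lemma \<mu>_countably_subadditive:
  fixes A :: "nat \<Rightarrow> 'x set"
  shows "ennreal (\<mu> (\<Union>i. A i)) \<le> (\<Sum>i. ennreal (\<mu> (A i)))"
proof (rule ennreal_le_epsilon)
  fix e :: real assume "0 < e"
  have "\<exists>U. open U \<and> A i \<subseteq> U \<and> v U < \<mu> (A i) + e * (1/2) ^ Suc i" for i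
    using \<mu>_less_ex[of "A i" "\<mu> (A i) + e * (1/2) ^ Suc i"] \<open>0 < e\<close> by (metis less_add_same_cancel1 mult_pos_pos zero_less_divide_1_iff zero_less_numeral zero_less_power)
  then obtain U where U: "\<And>i. open (U i)" "\<And>i. A i \<subseteq> U i" "\<And>i. v (U i) < \<mu> (A i) + e * (1/2) ^ Suc i"
    by metis
  have "ennreal (\<mu> (\<Union>i. A i)) \<le> ennreal (v (\<Union>i. U i))"
    using U by (intro ennreal_leI \<mu>_le) auto
  also have "\<dots> \<le> (\<Sum>i. ennreal (v (U i)))" using U(1) by (rule v_countably_subadditive)
  also have "\<dots> \<le> (\<Sum>i. ennreal (\<mu> (A i)) + ennreal (e * (1/2) ^ Suc i))"
    using U(3) \<open>0 < e\<close> by (intro suminf_le) (auto simp: ennreal_plus[symmetric] \<mu>_nonneg less_imp_le simp del: ennreal_plus intro!: ennreal_leI)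
  also have "\<dots> = (\<Sum>i. ennreal (\<mu> (A i))) + (\<Sum>i. ennreal (e * (1/2) ^ Suc i))"
    by (rule suminf_add[symmetric]) auto
  also have "(\<Sum>i. ennreal (e * (1/2) ^ Suc i)) = ennreal e"
    using sums_mult[OF power_half_series, of e] \<open>0 < e\<close> by (intro suminf_ennreal_eq) auto
  finally show "ennreal (\<mu> (\<Union>i. A i)) \<le> (\<Sum>i. ennreal (\<mu> (A i))) + ennreal e" .
qed

lemma \<mu>_empty: "\<mu> {} = 0"
proof -
  have "v {} \<le> 0" by (rule v_le) auto
  then show ?thesis using v_nonneg[of "{}"] by (simp add: \<mu>_open)
qed

lemma outer_measure_space_\<mu>: "outer_measure_space UNIV (\<lambda>A. ennreal (\<mu> A))"
  unfolding outer_measure_space_def positive_def increasing_def countably_subadditive_def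
  by (auto simp: \<mu>_empty \<mu>_mono ennreal_leI \<mu>_countably_subadditive)

lemma \<mu>_Un: "\<mu> (A \<union> B) \<le> \<mu> A + \<mu> B"
proof -
  interpret A: sigma_algebra UNIV "UNIV :: 'x set set" using sigma_algebra_Pow[of UNIV] by simp
  have "subadditive UNIV (\<lambda>A. ennreal (\<mu> A))"
    using outer_measure_space_\<mu> A.countably_subadditive_subadditive by (auto simp: outer_measure_space_def)
  have "ennreal (\<mu> (A \<union> (B - A))) \<le> ennreal (\<mu> A) + ennreal (\<mu> (B - A))"
    by (rule subadditiveD[OF \<open>subadditive UNIV _\<close>]) auto
  then have "\<mu> (A \<union> B) \<le> \<mu> A + \<mu> (B - A)"
    by (simp add: ennreal_plus[symmetric] \<mu>_nonneg del: ennreal_plus)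
  then show ?thesis using \<mu>_mono[of "B - A" B] by auto
qed

text \<open>Caratheodory's condition for open sets. Inside an open \<open>W\<close> containing
  \<open>E\<close>, a compact \<open>K\<close> in \<open>U \<inter> W\<close> and a compact
  \<open>K'\<close> in \<open>W - K\<close> are disjoint, so their contents add up to at most
  \<open>v W\<close>.\<close>

lemma \<mu>_split_open:
  assumes "open U"
  shows "\<mu> (U \<inter> E) + \<mu> (E - U) = \<mu> E"
proof (rule antisym)
  show "\<mu> E \<le> \<mu> (U \<inter> E) + \<mu> (E - U)"
    using \<mu>_Un[of "U \<inter> E" "E - U"] by (metis Int_Diff_Un Int_commute)
  show "\<mu> (U \<inter> E) + \<mu> (E - U) \<le> \<mu> E"
  proof (rule le_\<mu>)
    fix W assume W: "open W" "E \<subseteq> W"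
    have "v (U \<inter> W) \<le> v W - \<mu> (W - U)"
    proof (rule v_le)
      fix K assume K: "compact K" "K \<subseteq> U \<inter> W"
      have "open (W - K)" using W(1) compact_imp_closed[OF K(1)] by (rule open_Diff)
      then have "\<mu> (W - U) \<le> v (W - K)" using K(2) by (intro \<mu>_le) auto
      also have "\<dots> \<le> v W - m K"
      proof (rule v_le)
        fix K' assume K': "compact K'" "K' \<subseteq> W - K"
        have "m K + m K' = m (K \<union> K')" using K' by (intro additive[symmetric]) auto
        also have "\<dots> \<le> v W" using K K' by (intro le_v compact_Un) auto
        finally show "m K' \<le> v W - m K" by simp
      qed
      finally show "m K \<le> v W - \<mu> (W - U)" by simp
    qed
    moreover have "\<mu> (U \<inter> E) \<le> v (U \<inter> W)" "\<mu> (E - U) \<le> \<mu> (W - U)"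
      using W assms by (auto intro!: \<mu>_le \<mu>_mono)
    ultimately show "\<mu> (U \<inter> E) + \<mu> (E - U) \<le> v W" by linarith
  qed
qed

text \<open>Caratheodory's theorem gives a measure on the Borel sets. It is outer regular by
  construction, and complements turn this into inner regularity because closed sets are compact
  here.\<close>

lemma induced_radon_prob:
  obtains M where "radon_prob M" "\<And>A. A \<in> sets borel \<Longrightarrow> emeasure M A = ennreal (\<mu> A)"
proof -
  interpret A: sigma_algebra UNIV "UNIV :: 'x set set" using sigma_algebra_Pow[of UNIV] by simp
  let ?\<mu> = "\<lambda>A. ennreal (\<mu> A)"
  define L where "L = lambda_system UNIV UNIV ?\<mu>"
  have L: "measure_space UNIV L ?\<mu>"
    unfolding L_def by (rule A.caratheodory_lemma[OF outer_measure_space_\<mu>])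
  then interpret L: sigma_algebra UNIV L by (simp add: measure_space_def)
  have "{S :: 'x set. open S} \<subseteq> L"
    by (auto simp: L_def lambda_system_def Diff_eq[symmetric] Compl_eq_Diff_UNIV[symmetric] Int_commute[of "- _"]
        ennreal_plus[symmetric] \<mu>_nonneg \<mu>_split_open simp del: ennreal_plus)
  then have "sets borel \<subseteq> L" unfolding sets_borel by (rule L.sigma_sets_subset)
  then have "measure_space UNIV (sets borel) ?\<mu>"
    using L sets.sigma_algebra_axioms[of "borel :: 'x measure"] by (intro measure_down[OF L]) auto
  define M where "M = measure_of UNIV (sets borel) ?\<mu>"
  have sets_M: "sets M = sets borel"
    unfolding M_def by (simp add: sets_measure_of_conv sets.sigma_sets_eq[of borel, simplified])
  have em: "emeasure M A = ?\<mu> A" if "A \<in> sets borel" for A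
    using \<open>measure_space UNIV (sets borel) ?\<mu>\<close> that sets_M
    by (intro emeasure_measure_of[OF M_def]) (auto simp: measure_space_def)
  have space_M: "space M = UNIV" using sets_eq_imp_space_eq[OF sets_M] by simp
  have "\<mu> UNIV = 1"
    using le_v[OF compact_space, of UNIV] v_le[of UNIV 1, OF le_one] by (simp add: \<mu>_open total)
  then interpret prob_space M by (intro prob_spaceI) (simp add: space_M em)
  have me: "measure M A = \<mu> A" if "A \<in> sets borel" for A
    by (simp add: measure_def em[OF that] \<mu>_nonneg)
  have "measure M A = (SUP K\<in>{K. compact K \<and> K \<subseteq> A}. measure M K)" if A: "A \<in> sets borel" for A
  proof (rule antisym)
    have bdd: "bdd_above (measure M ` {K. compact K \<and> K \<subseteq> A})"
      by (rule bdd_aboveI2[of _ _ 1]) simp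
    show "measure M A \<le> (SUP K\<in>{K. compact K \<and> K \<subseteq> A}. measure M K)"
    proof (rule field_le_epsilon)
      fix e :: real assume "0 < e"
      have "- A \<in> sets borel" using A by auto
      obtain U where U: "open U" "- A \<subseteq> U" "v U < \<mu> (- A) + e"
        by (rule \<mu>_less_ex[of "- A" "\<mu> (- A) + e"]) (use \<open>0 < e\<close> in auto)
      have "compact (- U)" using compact_diff[OF compact_space U(1)] by (simp add: Compl_eq_Diff_UNIV)
      then have "measure M (- U) \<le> (SUP K\<in>{K. compact K \<and> K \<subseteq> A}. measure M K)"
        using U(2) by (intro cSUP_upper bdd) auto
      moreover have "measure M (- U) = 1 - measure M U" "measure M (- A) = 1 - measure M A"
        using prob_compl[of U] prob_compl[of A] U(1) A by (simp_all add: sets_M space_M Compl_eq_Diff_UNIV)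
      ultimately show "measure M A \<le> (SUP K\<in>{K. compact K \<and> K \<subseteq> A}. measure M K) + e"
        using U(1,3) by (simp add: me \<mu>_open \<open>- A \<in> sets borel\<close>)
    qed
    show "(SUP K\<in>{K. compact K \<and> K \<subseteq> A}. measure M K) \<le> measure M A"
      using A by (intro cSUP_least finite_measure_mono) (auto simp: sets_M)
  qed
  then have "radon_prob M" by (simp add: radon_prob_def sets_M prob_space_axioms)
  with em that show ?thesis by blast
qed

end

context tame_dynamics
begin

lemma act_inverse [simp]: "act (- g) (act g x) = x" "act g (act (- g) x) = x"
  by (simp_all add: act_add[symmetric])

section \<open>Existence\<close>

text \<open>Visit frequencies of one orbit over ever more invariant lists: along an ultrafilter
  satisfying every requirement the error is below each \<open>\<eta>\<close>, so the limit is
  exactly invariant.\<close>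

lemma invariant_finadd_exists:
  obtains m where "finadd m" "\<And>g Y. m (act g -` Y) = m Y"
proof -
  define S where "S = (\<lambda>(g :: 'g, \<eta>). {L. L \<noteq> [] \<and> almost_inv L g \<eta>})"
  obtain U where U: "ultrafilter U" "\<And>A. A \<in> S ` (UNIV \<times> {0<..}) \<Longrightarrow> eventually (\<lambda>L. L \<in> A) U"
  proof (rule ultrafilter_finite_intersections[of "S ` (UNIV \<times> {0<..})"])
    fix Y assume "finite Y" "Y \<subseteq> S ` (UNIV \<times> {0<..})"
    then obtain X where X: "X \<subseteq> UNIV \<times> {0<..}" "finite X" "Y = S ` X"
      by (meson finite_subset_image)
    obtain L :: "'g list" where "L \<noteq> []" "\<And>g \<eta>. (g, \<eta>) \<in> X \<Longrightarrow> almost_inv L g \<eta>"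
      using almost_inv_exists[OF X(2)] X(1) by auto
    then have "L \<in> \<Inter>Y" by (auto simp: X(3) S_def)
    then show "\<Inter>Y \<noteq> {}" by blast
  qed blast
  have SU: "eventually (\<lambda>L. L \<noteq> [] \<and> almost_inv L g \<eta>) U" if "\<eta> > 0" for g \<eta>
    using U(2)[of "S (g, \<eta>)"] that by (auto simp: S_def)
  fix x :: 'x
  define \<nu> where "\<nu> L Y = list_frac L ((\<lambda>t. act t x) -` Y)" for L Y
  have "eventually (\<lambda>L. finadd (\<nu> L)) U"
    using SU[of 1 0] by (auto elim!: eventually_mono simp: \<nu>_def[abs_def] intro!: finadd.vimage finadd_list_frac)
  note lim = finadd_Lim[OF U(1) this]
  define m where "m Y = Lim U (\<lambda>L. \<nu> L Y)" for Y
  have m: "((\<lambda>L. \<nu> L Y) \<longlongrightarrow> m Y) U" for Y unfolding m_def by (rule lim(2))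
  have "m (act g -` Y) = m Y" for g Y
  proof -
    have "\<bar>m (act g -` Y) - m Y\<bar> \<le> 0 + \<eta>" if "\<eta> > 0" for \<eta>
    proof (rule tendsto_upperbound)
      show "((\<lambda>L. \<bar>\<nu> L (act g -` Y) - \<nu> L Y\<bar>) \<longlongrightarrow> \<bar>m (act g -` Y) - m Y\<bar>) U"
        by (intro tendsto_intros m)
      show "eventually (\<lambda>L. \<bar>\<nu> L (act g -` Y) - \<nu> L Y\<bar> \<le> 0 + \<eta>) U"
        using SU[OF that, of g]
      proof eventually_elim
        case (elim L)
        from almost_inv_list_frac[of L g \<eta> "(\<lambda>t. act t x) -` Y"] elim show ?case
          by (simp add: \<nu>_def vimage_def act_add[symmetric] add.commute)
      qed
    qed (rule ultrafilter_not_bot[OF U(1)])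
    then have "\<bar>m (act g -` Y) - m Y\<bar> \<le> 0" by (rule field_le_epsilon)
    then show ?thesis by simp
  qed
  moreover have "finadd m" unfolding m_def[abs_def] by (rule lim(1))
  ultimately show ?thesis using that by blast
qed

text \<open>\<open>M\<close> need not agree with \<open>m\<close>, so invariance is transferred
  through the construction: each \<open>act g\<close> permutes the compact and the open sets.
  Applying the inequality to \<open>- g\<close> as well gives equality.\<close>

lemma invariant_radon_exists: "\<exists>M. radon_prob M \<and> invariant_measure act M"
proof -
  obtain m where m: "finadd m" and inv: "\<And>g Y. m (act g -` Y) = m Y"
    using invariant_finadd_exists by blast
  interpret compact_content m
    by (rule compact_content.intro[OF m]) (unfold_locales, rule compact_UNIV)
  obtain M where M: "radon_prob M" "\<And>A. A \<in> sets borel \<Longrightarrow> emeasure M A = ennreal (outer_content m A)"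
    using induced_radon_prob by blast
  have v_le_v: "v (act g -` U) \<le> v U" for g U
  proof (rule v_le)
    fix K assume K: "compact K" "K \<subseteq> act g -` U"
    have "act g -` (act g ` K) = K"
      by (auto simp: image_iff) (metis act_inverse(1))
    then have "m K = m (act g ` K)" using inv[of g "act g ` K"] by simp
    also have "\<dots> \<le> v U"
      using K by (intro le_v compact_continuous_image continuous_on_subset[OF continuous_act]) auto
    finally show "m K \<le> v U" .
  qed
  have \<mu>_le_\<mu>: "\<mu> (act g -` A) \<le> \<mu> A" for g A
  proof (rule le_\<mu>)
    fix U assume U: "open U" "A \<subseteq> U"
    have "\<mu> (act g -` A) \<le> v (act g -` U)"
      using U by (intro \<mu>_le open_vimage continuous_act) auto
    also have "\<dots> \<le> v U" by (rule v_le_v)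
    finally show "\<mu> (act g -` A) \<le> v U" .
  qed
  have "\<mu> (act g -` A) = \<mu> A" for g A
    using \<mu>_le_\<mu>[of g A] \<mu>_le_\<mu>[of "- g" "act g -` A"] by (simp add: vimage_def)
  moreover have "act g -` A \<in> sets borel" if "A \<in> sets borel" for g A
    using measurable_sets[OF borel_measurable_continuous_onI[OF continuous_act] that] by simp
  ultimately have "invariant_measure act M"
    unfolding invariant_measure_def by (simp add: M(2))
  with M(1) show ?thesis by blast
qed

section \<open>Uniqueness\<close>

lemma cont_integrable:
  fixes f :: "'x \<Rightarrow> real"
  assumes "radon_prob M" "continuous_on UNIV f"
  shows "integrable M f"
proof -
  interpret prob_space M using assms(1) by (simp add: radon_prob_def)
  obtain B where "\<And>x. \<bar>f x\<bar> \<le> B" using bounded_cont[OF assms(2)] by blast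
  moreover have "f \<in> borel_measurable M"
    using assms borel_measurable_continuous_onI[OF assms(2)] by (simp add: radon_prob_def cong: measurable_cong_sets)
  ultimately show ?thesis by (intro integrable_const_bound[where B = B]) auto
qed

lemma integral_act:
  fixes f :: "'x \<Rightarrow> real"
  assumes M: "radon_prob M" "invariant_measure act M" and f: "continuous_on UNIV f"
  shows "(\<integral>x. f (act g x) \<partial>M) = (\<integral>x. f x \<partial>M)"
proof -
  have sets: "sets M = sets borel" using M(1) by (simp add: radon_prob_def)
  have space: "space M = UNIV" using sets_eq_imp_space_eq[OF sets] by simp
  have act: "act g \<in> measurable M borel"
    using borel_measurable_continuous_onI[OF continuous_act] by (simp add: measurable_cong_sets[OF sets refl])
  have "distr M borel (act g) = M"
  proof (rule measure_eqI)
    fix A assume "A \<in> sets (distr M borel (act g))"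
    then show "emeasure (distr M borel (act g)) A = emeasure M A"
      using M(2) act by (simp add: emeasure_distr space invariant_measure_def)
  qed (simp add: sets)
  then show ?thesis
    using integral_distr[OF act borel_measurable_continuous_onI[OF f]] by simp
qed

lemma integral_list_avg:
  fixes f :: "'x \<Rightarrow> real"
  assumes M: "radon_prob M" "invariant_measure act M" and f: "continuous_on UNIV f" and L: "L \<noteq> []"
  shows "(\<integral>x. list_avg L (\<lambda>t. f (act t x)) \<partial>M) = (\<integral>x. f x \<partial>M)"
proof -
  have int: "integrable M (\<lambda>x. f (act t x))" for t
    using cont_integrable[OF M(1) continuous_f_act[OF f]] .
  have "integrable M (\<lambda>x. \<Sum>t\<leftarrow>L. f (act t x)) \<and> (\<integral>x. (\<Sum>t\<leftarrow>L. f (act t x)) \<partial>M) = real (length L) * (\<integral>x. f x \<partial>M)" for L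
    by (induction L) (auto simp: int integral_act[OF M f] algebra_simps)
  then show ?thesis using L by (simp add: list_avg_def)
qed

text \<open>An invariant measure gives \<open>f\<close> and its average \<open>A\<close> the same
  integral, and all values of \<open>A\<close> lie within \<open>e / 2\<close> of
  \<open>A x0\<close>.\<close>

lemma integral_le_of_invariant:
  fixes f :: "'x \<Rightarrow> real"
  assumes min: "minimal_system act"
    and M: "radon_prob M" "invariant_measure act M" and N: "radon_prob N" "invariant_measure act N"
    and f: "continuous_on UNIV f"
  shows "(\<integral>x. f x \<partial>M) \<le> (\<integral>x. f x \<partial>N)"
proof (rule field_le_epsilon)
  fix e :: real assume "0 < e"
  interpret M: prob_space M using M by (simp add: radon_prob_def)
  interpret N: prob_space N using N by (simp add: radon_prob_def)
  obtain L where L: "L \<noteq> []"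
    "\<And>x y. list_avg L (\<lambda>t. f (act t y)) - list_avg L (\<lambda>t. f (act t x)) \<le> e / 2"
    using small_oscillation[OF min f, of "e / 2"] \<open>0 < e\<close> by auto
  define A where "A u = list_avg L (\<lambda>t. f (act t u))" for u
  have A: "continuous_on UNIV A"
    unfolding A_def[abs_def] by (intro continuous_on_list_avg continuous_f_act f)
  have osc: "A y - A x \<le> e / 2" for x y using L(2) by (simp add: A_def)
  fix x0 :: 'x
  have le: "A x \<le> A x0 + e / 2" "A x0 - e / 2 \<le> A x" for x
    using osc[of x x0] osc[of x0 x] by linarith+
  have "(\<integral>x. A x \<partial>M) \<le> (\<integral>x. A x0 + e / 2 \<partial>M)"
    by (intro integral_mono cont_integrable[OF M(1)] A continuous_on_const le)
  moreover have "(\<integral>x. A x0 - e / 2 \<partial>N) \<le> (\<integral>x. A x \<partial>N)"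
    by (intro integral_mono cont_integrable[OF N(1)] A continuous_on_const le)
  moreover have "(\<integral>x. A x \<partial>M) = (\<integral>x. f x \<partial>M)" "(\<integral>x. A x \<partial>N) = (\<integral>x. f x \<partial>N)"
    unfolding A_def using integral_list_avg M N f L(1) by auto
  ultimately show "(\<integral>x. f x \<partial>M) \<le> (\<integral>x. f x \<partial>N) + e"
    by (simp add: M.prob_space N.prob_space)
qed

end

section \<open>Comparison of Radon measures through continuous functions\<close>

lemma compact_urysohn:
  fixes K U :: "'x::t2_space set"
  assumes "compact (UNIV :: 'x set)" "compact K" "open U" "K \<subseteq> U"
  obtains f :: "'x \<Rightarrow> real" where "continuous_on UNIV f" "\<And>x. 0 \<le> f x" "\<And>x. f x \<le> 1"
    "\<And>x. x \<in> K \<Longrightarrow> f x = 1" "\<And>x. x \<notin> U \<Longrightarrow> f x = 0"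
proof -
  have "compact_space (euclidean :: 'x topology)"
    using assms(1) by (simp add: compact_space_def compactin_euclidean_iff)
  then have "normal_space (euclidean :: 'x topology)"
    using Hausdorff_space_t2 compact_Hausdorff_or_regular_imp_normal_space by blast
  moreover have "closedin euclidean (- U)" "closedin euclidean K" "disjnt (- U) K"
    using assms by (auto simp: disjnt_iff compact_imp_closed closed_closedin[symmetric])
  ultimately obtain f :: "'x \<Rightarrow> real" where f: "continuous_map euclidean (top_of_set {0..1}) f"
    "f ` (- U) \<subseteq> {0}" "f ` K \<subseteq> {1}"
    using Urysohn_lemma[of euclidean "- U" K 0 1] by auto
  then have "continuous_on UNIV f" "\<And>x. f x \<in> {0..1}"
    by (auto simp: continuous_map_in_subtopology)
  with f that show ?thesis by (auto simp: image_subset_iff)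
qed

text \<open>Inner regularity of \<open>N\<close> on the complement of \<open>K\<close> supplies a
  compact \<open>C\<close> whose complement is a neighbourhood of \<open>K\<close> of nearly the
  same \<open>N\<close>-measure; a Urysohn function lies between the indicators of \<open>K\<close>
  and \<open>- C\<close>.\<close>

lemma radon_prob_le_compact:
  fixes M N :: "'x::t2_space measure"
  assumes "compact (UNIV :: 'x set)" and M: "radon_prob M" and N: "radon_prob N"
    and le: "\<And>f :: 'x \<Rightarrow> real. continuous_on UNIV f \<Longrightarrow> (\<integral>x. f x \<partial>M) \<le> (\<integral>x. f x \<partial>N)"
    and K: "compact K"
  shows "measure M K \<le> measure N K"
proof (rule field_le_epsilon)
  fix e :: real assume "0 < e"
  interpret M: prob_space M using M by (simp add: radon_prob_def)
  interpret N: prob_space N using N by (simp add: radon_prob_def)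
  have sets: "sets M = sets borel" "sets N = sets borel" using M N by (auto simp: radon_prob_def)
  have space: "space M = UNIV" "space N = UNIV" using sets[THEN sets_eq_imp_space_eq] by auto
  have Kb: "K \<in> sets borel" using compact_imp_closed[OF K] by simp
  then have "measure N (- K) = (SUP C\<in>{C. compact C \<and> C \<subseteq> - K}. measure N C)"
    using N by (auto simp: radon_prob_def)
  moreover have "{C. compact C \<and> C \<subseteq> - K} \<noteq> {}" "bdd_above (measure N ` {C. compact C \<and> C \<subseteq> - K})"
    by (auto intro!: bdd_aboveI2[of _ _ 1] exI[of _ "{}"])
  ultimately obtain C where C: "compact C" "C \<subseteq> - K" "measure N (- K) - e < measure N C"
    using less_cSUP_iff[of "{C. compact C \<and> C \<subseteq> - K}" "measure N" "measure N (- K) - e"] \<open>0 < e\<close> by auto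
  have Cb: "C \<in> sets borel" using compact_imp_closed[OF C(1)] by simp
  have "open (- C)" "K \<subseteq> - C" using C compact_imp_closed by auto
  from compact_urysohn[OF assms(1) K this] obtain f :: "'x \<Rightarrow> real" where
    f: "continuous_on UNIV f" "\<And>x. 0 \<le> f x" "\<And>x. f x \<le> 1" "\<And>x. x \<in> K \<Longrightarrow> f x = 1" "\<And>x. x \<notin> - C \<Longrightarrow> f x = 0"
    by blast
  have fm: "f \<in> borel_measurable borel" using f(1) by (rule borel_measurable_continuous_onI)
  have int: "integrable M f" "integrable N f"
    using fm f(2,3) by (auto intro!: M.integrable_const_bound[where B = 1] N.integrable_const_bound[where B = 1]
        simp: measurable_cong_sets[OF sets(1) refl] measurable_cong_sets[OF sets(2) refl])
  have "measure M K = (\<integral>x. indicator K x \<partial>M)"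
    using Kb by (simp add: sets space)
  also have "\<dots> \<le> (\<integral>x. f x \<partial>M)"
    using f int Kb by (intro integral_mono) (auto simp: sets M.emeasure_eq_measure split: split_indicator)
  also have "\<dots> \<le> (\<integral>x. f x \<partial>N)" using f(1) by (rule le)
  also have "\<dots> \<le> (\<integral>x. indicator (- C) x \<partial>N)"
    using f int Cb by (intro integral_mono) (auto simp: sets N.emeasure_eq_measure split: split_indicator)
  also have "\<dots> = measure N (- C)" by (simp add: space)
  also have "\<dots> = 1 - measure N C" using N.prob_compl[of C] Cb by (simp add: sets space Compl_eq_Diff_UNIV)
  also have "\<dots> \<le> 1 - measure N (- K) + e" using C(3) by simp
  also have "\<dots> = measure N K + e" using N.prob_compl[of K] Kb by (simp add: sets space Compl_eq_Diff_UNIV)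
  finally show "measure M K \<le> measure N K + e" .
qed

lemma radon_prob_eqI:
  fixes M N :: "'x::topological_space measure"
  assumes M: "radon_prob M" and N: "radon_prob N" and K: "\<And>K. compact K \<Longrightarrow> measure M K = measure N K"
  shows "M = N"
proof (rule measure_eqI)
  interpret M: prob_space M using M by (simp add: radon_prob_def)
  interpret N: prob_space N using N by (simp add: radon_prob_def)
  show "sets M = sets N" using M N by (simp add: radon_prob_def)
  fix A assume "A \<in> sets M"
  then have A: "A \<in> sets borel" using M by (simp add: radon_prob_def)
  have "measure M A = (SUP K\<in>{K. compact K \<and> K \<subseteq> A}. measure M K)"
    using M A unfolding radon_prob_def by blast
  also have "\<dots> = (SUP K\<in>{K. compact K \<and> K \<subseteq> A}. measure N K)"
    using K by (intro SUP_cong) auto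
  also have "\<dots> = measure N A"
    using N A unfolding radon_prob_def by metis
  finally show "emeasure M A = emeasure N A"
    by (simp add: M.emeasure_eq_measure N.emeasure_eq_measure)
qed

theorem theorem7p19:
  fixes act :: "'g::topological_ab_group_add \<Rightarrow> 'x::t2_space \<Rightarrow> 'x"
  assumes "dyn_system act"
    and "minimal_system act"
    and "tame_system act"
  shows "uniquely_ergodic act"
proof -
  interpret tame_dynamics act using assms by unfold_locales
  show ?thesis
    unfolding uniquely_ergodic_def
  proof (rule ex_ex1I[OF invariant_radon_exists])
    fix M N assume "radon_prob M \<and> invariant_measure act M" "radon_prob N \<and> invariant_measure act N"
    \<comment> \<open>The comparison applies in both directions, so \<open>M\<close> and
      \<open>N\<close> agree on compact sets.\<close>
    then show "M = N"
      using integral_le_of_invariant[OF assms(2)]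
      by (intro radon_prob_eqI antisym radon_prob_le_compact[OF compact_UNIV]) auto
  qed
qed

end
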